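(* Let $(L_i)_{i\in I}$ be an arbitrary family (indexed by an arbitrary set $I$) of countably presented frames. Then $$\Sigma\Big(\prod_{i\in I}L_i\Big)=\prod_{i\in I}\Sigma L_i ,$$ where the left-hand side is the set $\prod_{i\in I}L_i$ with the Scott topology of the coordinatewise order, and the right-hand side is the same set with the ordinary (Tychonoff) product of the Scott topologies of the $L_i$; that is, the two topologies coincide.
   Context: A frame (equivalently, complete Heyting algebra) is a complete lattice $L$ with $a\wedge\bigvee S=\bigvee_{s\in S}(a\wedge s)$ for all $a\in L$, $S\subseteq L$. A frame homomorphism preserves finite meets (including the top) and arbitrary joins. A frame is countably presented if it admits a presentation by generators and relations in the category of frames with countably many generators and countably many relations (i.e. it is isomorphic to the quotient of the free frame on a countable set by the frame congruence generated by a countable set of pairs of elements). For a poset $P$, a subset $U$ is Scott open if it is an upper set and every directed set $D$ having a supremum $\bigvee D\in U$ meets $U$ (directed sets are nonempty); $\sigma(P)$ is the Scott topology and $\Sigma P=(P,\sigma(P))$. *)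

theory Defs
  imports "HOL-Analysis.Function_Topology" "HOL-Algebra.Complete_Lattice" "HOL-Library.Countable_Set"
begin

section \<open>Frames and frame homomorphisms\<close>

locale frame = complete_lattice L for L (structure) +
  assumes meet_sup_distrib:
    "\<lbrakk>a \<in> carrier L; S \<subseteq> carrier L\<rbrakk> \<Longrightarrow> a \<sqinter> (\<Squnion>S) = \<Squnion>((\<lambda>s. a \<sqinter> s) ` S)"

definition frame_hom ::
    "('a, 'c) gorder_scheme \<Rightarrow> ('b, 'd) gorder_scheme \<Rightarrow> ('a \<Rightarrow> 'b) \<Rightarrow> bool"
  where "frame_hom L M h \<longleftrightarrow>
     h \<in> carrier L \<rightarrow> carrier M \<and>
     h \<top>\<^bsub>L\<^esub> = \<top>\<^bsub>M\<^esub> \<and>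
     (\<forall>a\<in>carrier L. \<forall>b\<in>carrier L. h (a \<sqinter>\<^bsub>L\<^esub> b) = h a \<sqinter>\<^bsub>M\<^esub> h b) \<and>
     (\<forall>S. S \<subseteq> carrier L \<longrightarrow> h (\<Squnion>\<^bsub>L\<^esub>S) = \<Squnion>\<^bsub>M\<^esub>(h ` S))"

definition frame_isomorphic ::
    "('a, 'c) gorder_scheme \<Rightarrow> ('b, 'd) gorder_scheme \<Rightarrow> bool"
  where "frame_isomorphic L M \<longleftrightarrow>
     (\<exists>h. frame_hom L M h \<and> bij_betw h (carrier L) (carrier M))"


section \<open>Free frames\<close>

text \<open>
  The standard construction of the free frame on a set \<open>X\<close>: the free meet-semilattice with top
  on \<open>X\<close> consists of the finite subsets of \<open>X\<close> (a finite set standing for the meet of its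
  elements, so ordered by reverse inclusion), and the free frame on \<open>X\<close> consists of the lower
  sets of that semilattice, i.e. of the sets of finite subsets of \<open>X\<close> that are closed under
  finite supersets. The universal property is proved below as
  \<open>free_frame_extension\<close> and \<open>free_frame_extension_unique\<close>.
\<close>

definition free_frame :: "'x set \<Rightarrow> 'x set set gorder"
  where "free_frame X =
    \<lparr>carrier = {U. U \<subseteq> Fpow X \<and> (\<forall>F\<in>U. \<forall>G\<in>Fpow X. F \<subseteq> G \<longrightarrow> G \<in> U)},
     eq = (=), le = (\<subseteq>)\<rparr>"

definition free_frame_gen :: "'x set \<Rightarrow> 'x \<Rightarrow> 'x set set"
  where "free_frame_gen X x = {F \<in> Fpow X. x \<in> F}"


section \<open>Frame congruences and quotients\<close>

text \<open>In the last clause, a subset \<open>T\<close> of \<open>\<theta>\<close> plays the role of a family of related pairs.\<close>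

definition frame_congruence :: "('a, 'c) gorder_scheme \<Rightarrow> ('a \<times> 'a) set \<Rightarrow> bool"
  where "frame_congruence L \<theta> \<longleftrightarrow>
     equiv (carrier L) \<theta> \<and>
     (\<forall>a b c d. (a, b) \<in> \<theta> \<longrightarrow> (c, d) \<in> \<theta> \<longrightarrow> (a \<sqinter>\<^bsub>L\<^esub> c, b \<sqinter>\<^bsub>L\<^esub> d) \<in> \<theta>) \<and>
     (\<forall>T. T \<subseteq> \<theta> \<longrightarrow> (\<Squnion>\<^bsub>L\<^esub>(fst ` T), \<Squnion>\<^bsub>L\<^esub>(snd ` T)) \<in> \<theta>)"

definition generated_congruence ::
    "('a, 'c) gorder_scheme \<Rightarrow> ('a \<times> 'a) set \<Rightarrow> ('a \<times> 'a) set"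
  where "generated_congruence L R = \<Inter>{\<theta>. frame_congruence L \<theta> \<and> R \<subseteq> \<theta>}"

text \<open>
  The order on classes is the one induced by the quotient meet:
  \<open>[a] \<le> [b]\<close> iff \<open>[a \<sqinter> b] = [a]\<close> (\<open>quotient_le_iff\<close> below). With it the quotient is a frame and
  the projection a frame homomorphism with kernel \<open>\<theta>\<close> (\<open>quotient_class_eq_iff\<close>,
  \<open>frame_frame_quotient\<close>, \<open>frame_hom_quotient\<close>).
\<close>

definition frame_quotient ::
    "('a, 'c) gorder_scheme \<Rightarrow> ('a \<times> 'a) set \<Rightarrow> 'a set gorder"
  where "frame_quotient L \<theta> =
    \<lparr>carrier = carrier L // \<theta>, eq = (=),
     le = (\<lambda>A B. \<exists>a\<in>A. \<exists>b\<in>B. a \<sqsubseteq>\<^bsub>L\<^esub> b)\<rparr>"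


section \<open>Countably presented frames\<close>

text \<open>
  Every countable set is in bijection with a subset of the natural numbers (finite sets
  included), so taking the generators from \<^typ>\<open>nat\<close> is no restriction.
\<close>

definition countably_presented :: "('a, 'c) gorder_scheme \<Rightarrow> bool"
  where "countably_presented L \<longleftrightarrow>
    (\<exists>(X :: nat set) R.
       R \<subseteq> carrier (free_frame X) \<times> carrier (free_frame X) \<and> countable R \<and>
       frame_isomorphic L
         (frame_quotient (free_frame X) (generated_congruence (free_frame X) R)))"


section \<open>The Scott topology and products of posets\<close>

definition directed_in :: "('a, 'c) gorder_scheme \<Rightarrow> 'a set \<Rightarrow> bool"
  where "directed_in P D \<longleftrightarrow>
     D \<subseteq> carrier P \<and> D \<noteq> {} \<and>
     (\<forall>x\<in>D. \<forall>y\<in>D. \<exists>z\<in>D. x \<sqsubseteq>\<^bsub>P\<^esub> z \<and> y \<sqsubseteq>\<^bsub>P\<^esub> z)"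

definition scott_open :: "('a, 'c) gorder_scheme \<Rightarrow> 'a set \<Rightarrow> bool"
  where "scott_open P U \<longleftrightarrow>
     U \<subseteq> carrier P \<and>
     (\<forall>x\<in>U. \<forall>y\<in>carrier P. x \<sqsubseteq>\<^bsub>P\<^esub> y \<longrightarrow> y \<in> U) \<and>
     (\<forall>D s. directed_in P D \<longrightarrow> is_lub P s D \<longrightarrow> s \<in> U \<longrightarrow> D \<inter> U \<noteq> {})"

definition scott_topology :: "('a, 'c) gorder_scheme \<Rightarrow> 'a topology"
  where "scott_topology P = topology (scott_open P)"

definition product_order :: "'i set \<Rightarrow> ('i \<Rightarrow> ('a, 'c) gorder_scheme) \<Rightarrow> ('i \<Rightarrow> 'a) gorder"
  where "product_order I L =
    \<lparr>carrier = (\<Pi>\<^sub>E i\<in>I. carrier (L i)), eq = (=),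
     le = (\<lambda>f g. \<forall>i\<in>I. f i \<sqsubseteq>\<^bsub>L i\<^esub> g i)\<rparr>"


section \<open>Basic facts about these notions\<close>

lemma istopology_scott_open: "istopology (scott_open P)"
  unfolding istopology_def
proof (intro conjI allI impI)
  fix S T assume S: "scott_open P S" and T: "scott_open P T"
  have upS: "y \<in> V" if "scott_open P V" "x \<in> V" "y \<in> carrier P" "x \<sqsubseteq>\<^bsub>P\<^esub> y" for V x y
    using that by (simp add: scott_open_def)
  show "scott_open P (S \<inter> T)"
    unfolding scott_open_def
  proof (intro conjI allI impI ballI)
    show "S \<inter> T \<subseteq> carrier P" using S by (auto simp: scott_open_def)
  next
    fix x y assume "x \<in> S \<inter> T" "y \<in> carrier P" "x \<sqsubseteq>\<^bsub>P\<^esub> y"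
    then show "y \<in> S \<inter> T" using upS[OF S] upS[OF T] by blast
  next
    fix D s assume D: "directed_in P D" and s: "is_lub P s D" "s \<in> S \<inter> T"
    obtain u where u: "u \<in> D" "u \<in> S" using S D s unfolding scott_open_def by blast
    obtain v where v: "v \<in> D" "v \<in> T" using T D s unfolding scott_open_def by blast
    obtain w where w: "w \<in> D" "u \<sqsubseteq>\<^bsub>P\<^esub> w" "v \<sqsubseteq>\<^bsub>P\<^esub> w"
      using D u v unfolding directed_in_def by blast
    have "w \<in> carrier P" using D w unfolding directed_in_def by blast
    then have "w \<in> S \<inter> T" using upS[OF S u(2)] upS[OF T v(2)] w by blast
    then show "D \<inter> (S \<inter> T) \<noteq> {}" using w by blast
  qed
next
  fix K assume K: "\<forall>S\<in>K. scott_open P S"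
  show "scott_open P (\<Union>K)"
    unfolding scott_open_def
  proof (intro conjI allI impI ballI)
    show "\<Union>K \<subseteq> carrier P" using K by (auto simp: scott_open_def)
  next
    fix x y assume "x \<in> \<Union>K" "y \<in> carrier P" "x \<sqsubseteq>\<^bsub>P\<^esub> y"
    then obtain S where S: "S \<in> K" "x \<in> S" by blast
    then have "scott_open P S" using K by blast
    then have "y \<in> S"
      using S \<open>y \<in> carrier P\<close> \<open>x \<sqsubseteq>\<^bsub>P\<^esub> y\<close> by (simp add: scott_open_def)
    then show "y \<in> \<Union>K" using S by blast
  next
    fix D s assume D: "directed_in P D" "is_lub P s D" and "s \<in> \<Union>K"
    then obtain S where S: "S \<in> K" "s \<in> S" by blast
    then have "scott_open P S" using K by blast
    then have "D \<inter> S \<noteq> {}" using S D by (simp add: scott_open_def)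
    then show "D \<inter> \<Union>K \<noteq> {}" using S by blast
  qed
qed

lemma openin_scott_topology: "openin (scott_topology P) U \<longleftrightarrow> scott_open P U"
  by (simp add: scott_topology_def istopology_scott_open)

lemma topspace_scott_topology: "topspace (scott_topology P) = carrier P"
proof
  show "topspace (scott_topology P) \<subseteq> carrier P"
    using openin_topspace[of "scott_topology P"]
    unfolding openin_scott_topology scott_open_def by blast
  have "scott_open P (carrier P)"
    unfolding scott_open_def directed_in_def by blast
  then show "carrier P \<subseteq> topspace (scott_topology P)"
    by (simp add: openin_scott_topology openin_subset)
qed

lemma (in partial_order) complete_lattice_from_sups:
  assumes sups: "\<And>A. A \<subseteq> carrier L \<Longrightarrow> \<exists>s. is_lub L s A"
  shows "complete_lattice L"
proof
  fix A assume A: "A \<subseteq> carrier L"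
  show "\<exists>s. is_lub L s A" using sups[OF A] .
  obtain s where s: "is_lub L s (Lower L A)"
    using sups[of "Lower L A"] by auto
  have "is_glb L s A"
  proof (rule greatest_LowerI)
    show sc: "s \<in> carrier L" using s by (meson Upper_closed least_mem subsetD)
    show "A \<subseteq> carrier L" by (rule A)
    show "s \<sqsubseteq> x" if "x \<in> A" for x
    proof (rule least_le[OF s])
      show "x \<in> Upper L (Lower L A)"
        using that A by (auto simp: Upper_def Lower_def)
    qed
    show "y \<sqsubseteq> s" if "y \<in> Lower L A" for y
      using least_Upper_above[OF s that] by simp
  qed
  then show "\<exists>i. is_glb L i A" by blast
qed

lemma (in complete_lattice) supI_eq:
  assumes "A \<subseteq> carrier L" "s \<in> carrier L" "\<And>x. x \<in> A \<Longrightarrow> x \<sqsubseteq> s"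
    "\<And>y. \<lbrakk>y \<in> carrier L; \<And>x. x \<in> A \<Longrightarrow> x \<sqsubseteq> y\<rbrakk> \<Longrightarrow> s \<sqsubseteq> y"
  shows "\<Squnion>A = s"
  using assms by (meson le_antisym sup_closed sup_least sup_upper)

lemma (in complete_lattice) meetI_eq:
  assumes "a \<in> carrier L" "b \<in> carrier L" "s \<in> carrier L" "s \<sqsubseteq> a" "s \<sqsubseteq> b"
    "\<And>y. \<lbrakk>y \<in> carrier L; y \<sqsubseteq> a; y \<sqsubseteq> b\<rbrakk> \<Longrightarrow> y \<sqsubseteq> s"
  shows "a \<sqinter> b = s"
  using assms by (meson le_antisym meet_closed meet_le meet_left meet_right)

lemma (in complete_lattice) topI_eq:
  assumes "s \<in> carrier L" "\<And>y. y \<in> carrier L \<Longrightarrow> y \<sqsubseteq> s"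
  shows "\<top> = s"
  using assms by (meson le_antisym top_closed top_higher)

subsection \<open>The free frame\<close>

lemma free_frame_le: "U \<sqsubseteq>\<^bsub>free_frame X\<^esub> V \<longleftrightarrow> U \<subseteq> V"
  by (simp add: free_frame_def)

lemma free_frame_carrier_Int:
  "\<lbrakk>U \<in> carrier (free_frame X); V \<in> carrier (free_frame X)\<rbrakk> \<Longrightarrow> U \<inter> V \<in> carrier (free_frame X)"
  by (auto simp: free_frame_def)

lemma free_frame_carrier_Union:
  assumes "S \<subseteq> carrier (free_frame X)"
  shows "\<Union>S \<in> carrier (free_frame X)"
proof -
  have *: "U \<subseteq> Fpow X \<and> (\<forall>F\<in>U. \<forall>G\<in>Fpow X. F \<subseteq> G \<longrightarrow> G \<in> U)" if "U \<in> S" for U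
    using assms that by (auto simp: free_frame_def)
  have "\<Union>S \<subseteq> Fpow X" using * by blast
  moreover have "G \<in> \<Union>S" if "F \<in> \<Union>S" "G \<in> Fpow X" "F \<subseteq> G" for F G
    using that * by (meson UnionE UnionI)
  ultimately show ?thesis by (auto simp: free_frame_def)
qed

lemma complete_lattice_free_frame: "complete_lattice (free_frame X)"
proof -
  interpret partial_order "free_frame X"
    by unfold_locales (auto simp: free_frame_def)
  show ?thesis
  proof (rule complete_lattice_from_sups)
    fix A assume A: "A \<subseteq> carrier (free_frame X)"
    have "is_lub (free_frame X) (\<Union>A) A"
    proof (rule least_UpperI)
      show "A \<subseteq> carrier (free_frame X)" "\<Union>A \<in> carrier (free_frame X)"
        using A free_frame_carrier_Union by auto
      show "U \<sqsubseteq>\<^bsub>free_frame X\<^esub> \<Union>A" if "U \<in> A" for U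
        using that by (auto simp: free_frame_le)
      show "\<Union>A \<sqsubseteq>\<^bsub>free_frame X\<^esub> V" if "V \<in> Upper (free_frame X) A" for V
        using that A unfolding Upper_def free_frame_le by blast
    qed
    then show "\<exists>s. is_lub (free_frame X) s A" ..
  qed
qed

lemma free_frame_top: "\<top>\<^bsub>free_frame X\<^esub> = Fpow X"
  by (rule complete_lattice.topI_eq[OF complete_lattice_free_frame]) (auto simp: free_frame_def)

lemma free_frame_sup:
  assumes "S \<subseteq> carrier (free_frame X)"
  shows "\<Squnion>\<^bsub>free_frame X\<^esub>S = \<Union>S"
  using assms free_frame_carrier_Union[OF assms]
  by (intro complete_lattice.supI_eq[OF complete_lattice_free_frame]) (auto simp: free_frame_le)

lemma free_frame_meet:
  assumes "U \<in> carrier (free_frame X)" "V \<in> carrier (free_frame X)"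
  shows "U \<sqinter>\<^bsub>free_frame X\<^esub> V = U \<inter> V"
  using assms free_frame_carrier_Int[OF assms]
  by (intro complete_lattice.meetI_eq[OF complete_lattice_free_frame]) (auto simp: free_frame_le)

lemma frame_free_frame: "frame (free_frame X)"
proof (rule frame.intro[OF complete_lattice_free_frame], unfold_locales)
  fix a S assume a: "a \<in> carrier (free_frame X)" and S: "S \<subseteq> carrier (free_frame X)"
  have im: "(\<lambda>s. a \<sqinter>\<^bsub>free_frame X\<^esub> s) ` S = (\<lambda>s. a \<inter> s) ` S"
    using a S by (intro image_cong) (auto simp: free_frame_meet)
  have "(\<lambda>s. a \<inter> s) ` S \<subseteq> carrier (free_frame X)"
    using a S free_frame_carrier_Int by blast
  then show "a \<sqinter>\<^bsub>free_frame X\<^esub> \<Squnion>\<^bsub>free_frame X\<^esub> S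
      = \<Squnion>\<^bsub>free_frame X\<^esub> ((\<lambda>s. a \<sqinter>\<^bsub>free_frame X\<^esub> s) ` S)"
    unfolding im using a S
    by (simp add: free_frame_sup free_frame_meet free_frame_carrier_Union)
qed

lemma free_frame_gen_closed: "x \<in> X \<Longrightarrow> free_frame_gen X x \<in> carrier (free_frame X)"
  by (auto simp: free_frame_def free_frame_gen_def)

lemma (in frame) sup_meet_distrib2:
  assumes "A \<subseteq> carrier L" "B \<subseteq> carrier L"
  shows "\<Squnion>A \<sqinter> \<Squnion>B = \<Squnion>{a \<sqinter> b |a b. a \<in> A \<and> b \<in> B}" (is "?l = \<Squnion>?C")
proof (rule le_antisym)
  have C: "?C \<subseteq> carrier L" using assms by (auto intro!: meet_closed)
  have AB: "\<Squnion>A \<in> carrier L" "\<Squnion>B \<in> carrier L" using assms by auto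
  show "?l \<in> carrier L" "\<Squnion>?C \<in> carrier L" 
    using AB by (auto intro: sup_closed[OF C])
  have *: "\<Squnion>A \<sqinter> b \<sqsubseteq> \<Squnion>?C" if b: "b \<in> B" for b
  proof -
    have bc: "b \<in> carrier L" using b assms by blast
    have eq: "\<Squnion>A \<sqinter> b = \<Squnion>((\<lambda>a. b \<sqinter> a) ` A)"
      unfolding meet_comm[of _ _ b] by (rule meet_sup_distrib[OF bc assms(1)])
    show ?thesis unfolding eq
    proof (rule sup_least)
      show "(\<lambda>a. b \<sqinter> a) ` A \<subseteq> carrier L" using bc assms by (auto intro!: meet_closed)
      show "\<Squnion>?C \<in> carrier L" by (rule sup_closed[OF C])
      fix x assume "x \<in> (\<lambda>a. b \<sqinter> a) ` A"
      then obtain a where "a \<in> A" "x = a \<sqinter> b" unfolding meet_comm[of _ b] by blast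
      then have "x \<in> ?C" using b by blast
      then show "x \<sqsubseteq> \<Squnion>?C" by (rule sup_upper[OF C])
    qed
  qed
  show "?l \<sqsubseteq> \<Squnion>?C"
    unfolding meet_sup_distrib[OF AB(1) assms(2)]
  proof (rule sup_least)
    show "(\<lambda>b. \<Squnion>A \<sqinter> b) ` B \<subseteq> carrier L" using AB assms by auto
    show "\<Squnion>?C \<in> carrier L" by (rule sup_closed[OF C])
    show "x \<sqsubseteq> \<Squnion>?C" if "x \<in> (\<lambda>b. \<Squnion>A \<sqinter> b) ` B" for x using that * by blast
  qed
  show "\<Squnion>?C \<sqsubseteq> ?l"
  proof (rule sup_least[OF C])
    show "?l \<in> carrier L" using AB by simp
    fix x assume "x \<in> ?C"
    then obtain a b where ab: "x = a \<sqinter> b" "a \<in> A" "b \<in> B" by blast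
    have c: "a \<in> carrier L" "b \<in> carrier L" using ab assms by auto
    have le: "a \<sqsubseteq> \<Squnion>A" "b \<sqsubseteq> \<Squnion>B" using ab assms by (auto intro: sup_upper)
    have m: "a \<sqinter> b \<in> carrier L" using c by simp
    show "x \<sqsubseteq> ?l" unfolding ab(1)
    proof (rule meet_le)
      show "a \<sqinter> b \<sqsubseteq> \<Squnion>A" using le_trans[OF meet_left[OF c] le(1)] c AB m by simp
      show "a \<sqinter> b \<sqsubseteq> \<Squnion>B" using le_trans[OF meet_right[OF c] le(2)] c AB m by simp
    qed (use AB m in auto)
  qed
qed

theorem free_frame_extension:
  assumes "frame L" and f: "f \<in> X \<rightarrow> carrier L"
  shows "\<exists>h. frame_hom (free_frame X) L h \<and> (\<forall>x\<in>X. h (free_frame_gen X x) = f x)"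
proof -
  interpret L: frame L by fact
  define m where "m F = \<Sqinter>\<^bsub>L\<^esub>(f ` F)" for F
  define h where "h U = \<Squnion>\<^bsub>L\<^esub>(m ` U)" for U
  have fc: "f ` F \<subseteq> carrier L" if "F \<in> Fpow X" for F
    using that f by (auto simp: Fpow_def)
  have mc: "m F \<in> carrier L" if "F \<in> Fpow X" for F
    unfolding m_def using fc[OF that] by simp
  have mant: "m G \<sqsubseteq>\<^bsub>L\<^esub> m F" if "F \<in> Fpow X" "G \<in> Fpow X" "F \<subseteq> G" for F G
  proof -
    have "m G \<sqsubseteq>\<^bsub>L\<^esub> z" if "z \<in> f ` F" for z
      unfolding m_def using that \<open>F \<subseteq> G\<close> L.inf_lower[OF fc[OF \<open>G \<in> Fpow X\<close>]] by blast
    then show ?thesis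
      unfolding m_def[of F] by (intro L.inf_greatest[OF fc[OF that(1)] mc[OF that(2)]])
  qed
  have mun: "m F \<sqinter>\<^bsub>L\<^esub> m G = m (F \<union> G)" if FG: "F \<in> Fpow X" "G \<in> Fpow X" for F G
  proof (rule L.meetI_eq)
    have U: "F \<union> G \<in> Fpow X" using FG by (auto simp: Fpow_def)
    show "m F \<in> carrier L" "m G \<in> carrier L" "m (F \<union> G) \<in> carrier L" using mc FG U by auto
    show "m (F \<union> G) \<sqsubseteq>\<^bsub>L\<^esub> m F" "m (F \<union> G) \<sqsubseteq>\<^bsub>L\<^esub> m G" using mant FG U by auto
    fix y assume y: "y \<in> carrier L" "y \<sqsubseteq>\<^bsub>L\<^esub> m F" "y \<sqsubseteq>\<^bsub>L\<^esub> m G"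
    show "y \<sqsubseteq>\<^bsub>L\<^esub> m (F \<union> G)"
      unfolding m_def
    proof (rule L.inf_greatest)
      show "f ` (F \<union> G) \<subseteq> carrier L" using fc U by blast
      show "y \<in> carrier L" by fact
      fix z assume "z \<in> f ` (F \<union> G)"
      then consider "z \<in> f ` F" | "z \<in> f ` G" by blast
      then show "y \<sqsubseteq>\<^bsub>L\<^esub> z"
      proof cases
        case 1
        then have "m F \<sqsubseteq>\<^bsub>L\<^esub> z" "z \<in> carrier L"
          unfolding m_def using L.inf_lower[OF fc[OF FG(1)]] fc[OF FG(1)] by blast+
        then show ?thesis using y mc FG by (meson L.le_trans)
      next
        case 2
        then have "m G \<sqsubseteq>\<^bsub>L\<^esub> z" "z \<in> carrier L"
          unfolding m_def using L.inf_lower[OF fc[OF FG(2)]] fc[OF FG(2)] by blast+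
        then show ?thesis using y mc FG by (meson L.le_trans)
      qed
    qed
  qed
  have UF: "U \<subseteq> Fpow X" if "U \<in> carrier (free_frame X)" for U
    using that by (auto simp: free_frame_def)
  have mU: "m ` U \<subseteq> carrier L" if "U \<in> carrier (free_frame X)" for U
    using UF[OF that] mc by blast
  have hc: "h U \<in> carrier L" if "U \<in> carrier (free_frame X)" for U
    unfolding h_def using mU[OF that] by simp
  have e: "{} \<in> Fpow X" by (auto simp: Fpow_def)
  have me: "m {} = \<top>\<^bsub>L\<^esub>"
  proof -
    have "\<top>\<^bsub>L\<^esub> = m {}"
      by (rule L.topI_eq) (use mc[OF e] in \<open>auto simp: m_def intro: L.inf_greatest\<close>)
    then show ?thesis by simp
  qed
  have Fc: "Fpow X \<in> carrier (free_frame X)" by (auto simp: free_frame_def)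
  have hhom: "frame_hom (free_frame X) L h"
    unfolding frame_hom_def
  proof (intro conjI ballI allI impI)
    show "h \<in> carrier (free_frame X) \<rightarrow> carrier L" using hc by auto
    have "\<top>\<^bsub>L\<^esub> \<sqsubseteq>\<^bsub>L\<^esub> h (Fpow X)"
      unfolding h_def me[symmetric] using mU[OF Fc] e by (intro L.sup_upper) auto
    then have "\<top>\<^bsub>L\<^esub> = h (Fpow X)" using hc[OF Fc]
      by (meson L.le_antisym L.top_closed L.top_higher)
    then show "h \<top>\<^bsub>free_frame X\<^esub> = \<top>\<^bsub>L\<^esub>" by (simp add: free_frame_top)
  next
    fix U V assume U: "U \<in> carrier (free_frame X)" and V: "V \<in> carrier (free_frame X)"
    have eq: "{a \<sqinter>\<^bsub>L\<^esub> b |a b. a \<in> m ` U \<and> b \<in> m ` V} = m ` (U \<inter> V)"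
    proof (intro equalityI subsetI)
      fix x assume "x \<in> {a \<sqinter>\<^bsub>L\<^esub> b |a b. a \<in> m ` U \<and> b \<in> m ` V}"
      then obtain F G where FG: "F \<in> U" "G \<in> V" "x = m F \<sqinter>\<^bsub>L\<^esub> m G" by blast
      have FG': "F \<in> Fpow X" "G \<in> Fpow X" using FG UF U V by auto
      then have "F \<union> G \<in> Fpow X" by (auto simp: Fpow_def)
      then have "F \<union> G \<in> U \<inter> V" using FG U V by (auto simp: free_frame_def)
      then show "x \<in> m ` (U \<inter> V)" using FG FG' mun by auto
    next
      fix x assume "x \<in> m ` (U \<inter> V)"
      then obtain F where F: "F \<in> U" "F \<in> V" "x = m F" by blast
      then have "x = m F \<sqinter>\<^bsub>L\<^esub> m F" using mun[of F F] UF[OF U] by auto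
      then show "x \<in> {a \<sqinter>\<^bsub>L\<^esub> b |a b. a \<in> m ` U \<and> b \<in> m ` V}" using F by blast
    qed
    show "h (U \<sqinter>\<^bsub>free_frame X\<^esub> V) = h U \<sqinter>\<^bsub>L\<^esub> h V"
      unfolding free_frame_meet[OF U V] h_def L.sup_meet_distrib2[OF mU[OF U] mU[OF V]] eq ..
  next
    fix S assume S: "S \<subseteq> carrier (free_frame X)"
    have hS: "h ` S \<subseteq> carrier L" using hc S by auto
    have uS: "m ` \<Union>S \<subseteq> carrier L" using mU S by blast
    show "h (\<Squnion>\<^bsub>free_frame X\<^esub> S) = \<Squnion>\<^bsub>L\<^esub> (h ` S)"
      unfolding free_frame_sup[OF S]
    proof (subst h_def, rule L.supI_eq[OF uS])
      show "\<Squnion>\<^bsub>L\<^esub> (h ` S) \<in> carrier L" using hS by simp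
      fix x assume "x \<in> m ` \<Union>S"
      then obtain U where U: "U \<in> S" "x \<in> m ` U" by blast
      then have Uc: "U \<in> carrier (free_frame X)" using S by blast
      have "x \<sqsubseteq>\<^bsub>L\<^esub> h U" unfolding h_def using mU[OF Uc] U by (intro L.sup_upper)
      moreover have "h U \<sqsubseteq>\<^bsub>L\<^esub> \<Squnion>\<^bsub>L\<^esub> (h ` S)" using hS U by (intro L.sup_upper) auto
      ultimately show "x \<sqsubseteq>\<^bsub>L\<^esub> \<Squnion>\<^bsub>L\<^esub> (h ` S)"
        using hS mU[OF Uc] U hc[OF Uc] by (meson L.le_trans L.sup_closed subsetD)
    next
      fix y assume y: "y \<in> carrier L" "\<And>x. x \<in> m ` \<Union>S \<Longrightarrow> x \<sqsubseteq>\<^bsub>L\<^esub> y"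
      show "\<Squnion>\<^bsub>L\<^esub> (h ` S) \<sqsubseteq>\<^bsub>L\<^esub> y"
      proof (rule L.sup_least[OF hS y(1)])
        fix z assume "z \<in> h ` S"
        then obtain U where U: "U \<in> S" "z = h U" by blast
        then have Uc: "U \<in> carrier (free_frame X)" using S by blast
        show "z \<sqsubseteq>\<^bsub>L\<^esub> y" unfolding U(2) h_def
          using y(1) y(2)[OF imageI] U(1) by (intro L.sup_least[OF mU[OF Uc]]) blast+
      qed
    qed
  qed
  have "h (free_frame_gen X x) = f x" if x: "x \<in> X" for x
  proof -
    have s: "{x} \<in> Fpow X" using x by (auto simp: Fpow_def)
    have fx: "f x \<in> carrier L" using f x by auto
    have ms: "m {x} = f x" unfolding m_def using fx by simp
    show ?thesis unfolding h_def
    proof (rule L.supI_eq[OF mU[OF free_frame_gen_closed[OF x]] fx])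
      fix y assume "y \<in> m ` free_frame_gen X x"
      then obtain F where "F \<in> Fpow X" "x \<in> F" "y = m F" by (auto simp: free_frame_gen_def)
      then show "y \<sqsubseteq>\<^bsub>L\<^esub> f x" using mant[OF s, of F] unfolding ms by simp
    next
      fix y assume "\<And>z. z \<in> m ` free_frame_gen X x \<Longrightarrow> z \<sqsubseteq>\<^bsub>L\<^esub> y"
      moreover have "f x \<in> m ` free_frame_gen X x"
        unfolding ms[symmetric] using s by (intro imageI) (simp add: free_frame_gen_def)
      ultimately show "f x \<sqsubseteq>\<^bsub>L\<^esub> y" by blast
    qed
  qed
  with hhom show ?thesis by blast
qed

theorem free_frame_extension_unique:
  assumes h: "frame_hom (free_frame X) L h" and k: "frame_hom (free_frame X) L k"
    and gen: "\<And>x. x \<in> X \<Longrightarrow> h (free_frame_gen X x) = k (free_frame_gen X x)"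
    and U: "U \<in> carrier (free_frame X)"
  shows "h U = k U"
proof -
  define p where "p F = {G \<in> Fpow X. F \<subseteq> G}" for F
  have pc: "p F \<in> carrier (free_frame X)" for F
    by (auto simp: free_frame_def p_def)
  have pp: "h (p F) = k (p F)" if "finite F" "F \<subseteq> X" for F
    using that
  proof (induction F rule: finite_induct)
    case empty
    have "p {} = \<top>\<^bsub>free_frame X\<^esub>" by (auto simp: p_def free_frame_top)
    then show ?case using h k by (simp add: frame_hom_def)
  next
    case (insert x F)
    have xc: "free_frame_gen X x \<in> carrier (free_frame X)"
      using insert by (simp add: free_frame_gen_closed)
    have "p (insert x F) = free_frame_gen X x \<sqinter>\<^bsub>free_frame X\<^esub> p F"
      unfolding free_frame_meet[OF xc pc] by (auto simp: p_def free_frame_gen_def)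
    then show ?case using h k xc pc insert gen by (simp add: frame_hom_def)
  qed
  have pU: "p ` U \<subseteq> carrier (free_frame X)" using pc by blast
  have "U = \<Squnion>\<^bsub>free_frame X\<^esub> (p ` U)"
    unfolding free_frame_sup[OF pU]
    using U by (auto simp: p_def free_frame_def)
  moreover have "h ` p ` U = k ` p ` U"
    using U pp unfolding image_image
    by (intro image_cong) (auto simp: free_frame_def Fpow_def)
  moreover have "h (\<Squnion>\<^bsub>free_frame X\<^esub> (p ` U)) = \<Squnion>\<^bsub>L\<^esub> (h ` p ` U)"
    "k (\<Squnion>\<^bsub>free_frame X\<^esub> (p ` U)) = \<Squnion>\<^bsub>L\<^esub> (k ` p ` U)"
    using h k pU by (simp_all add: frame_hom_def)
  ultimately show ?thesis by simp
qed

subsection \<open>Quotients\<close>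

lemma (in complete_lattice) frame_congruence_total:
  "frame_congruence L (carrier L \<times> carrier L)"
  unfolding frame_congruence_def
proof (intro conjI allI impI)
  show "equiv (carrier L) (carrier L \<times> carrier L)"
    by (auto simp: equiv_def refl_on_def sym_def trans_def)
  show "(a \<sqinter> c, b \<sqinter> d) \<in> carrier L \<times> carrier L"
    if "(a, b) \<in> carrier L \<times> carrier L" "(c, d) \<in> carrier L \<times> carrier L" for a b c d
    using that by auto
  show "(\<Squnion>(fst ` T), \<Squnion>(snd ` T)) \<in> carrier L \<times> carrier L"
    if "T \<subseteq> carrier L \<times> carrier L" for T
    using that by (auto intro!: sup_closed)
qed

lemma (in complete_lattice) frame_congruence_generated:
  assumes "R \<subseteq> carrier L \<times> carrier L"
  shows "frame_congruence L (generated_congruence L R)"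
    and "R \<subseteq> generated_congruence L R"
proof -
  let ?C = "{\<theta>. frame_congruence L \<theta> \<and> R \<subseteq> \<theta>}"
  have ne: "carrier L \<times> carrier L \<in> ?C" using assms frame_congruence_total by blast
  show "R \<subseteq> generated_congruence L R" by (auto simp: generated_congruence_def)
  have E: "equiv (carrier L) \<theta>" if "\<theta> \<in> ?C" for \<theta> using that by (auto simp: frame_congruence_def)
  have "equiv (carrier L) (\<Inter>?C)"
  proof (rule equivI)
    show "\<Inter>?C \<subseteq> carrier L \<times> carrier L" using ne by blast
    show "refl_on (carrier L) (\<Inter>?C)"
      using E ne unfolding equiv_def refl_on_def by blast
    show "sym (\<Inter>?C)" using E unfolding equiv_def sym_def by blast
    show "trans (\<Inter>?C)" using E unfolding equiv_def trans_def by blast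
  qed
  moreover have "(a \<sqinter> c, b \<sqinter> d) \<in> \<Inter>?C" if "(a, b) \<in> \<Inter>?C" "(c, d) \<in> \<Inter>?C" for a b c d
  proof
    fix \<theta> assume \<theta>: "\<theta> \<in> ?C"
    then have "frame_congruence L \<theta>" "(a, b) \<in> \<theta>" "(c, d) \<in> \<theta>" using that by auto
    then show "(a \<sqinter> c, b \<sqinter> d) \<in> \<theta>" by (simp add: frame_congruence_def)
  qed
  moreover have "(\<Squnion>(fst ` T), \<Squnion>(snd ` T)) \<in> \<Inter>?C" if "T \<subseteq> \<Inter>?C" for T
  proof
    fix \<theta> assume \<theta>: "\<theta> \<in> ?C"
    then have "frame_congruence L \<theta>" "T \<subseteq> \<theta>" using that by auto
    then show "(\<Squnion>(fst ` T), \<Squnion>(snd ` T)) \<in> \<theta>" by (simp add: frame_congruence_def)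
  qed
  ultimately show "frame_congruence L (generated_congruence L R)"
    unfolding generated_congruence_def frame_congruence_def[of L "\<Inter>?C"]
    by (intro conjI allI impI)
qed

context frame
begin

context
  fixes \<theta> assumes cong: "frame_congruence L \<theta>"
begin

private abbreviation (input) "Q \<equiv> frame_quotient L \<theta>"
private abbreviation (input) "cl a \<equiv> \<theta> `` {a}"

lemma equiv_theta: "equiv (carrier L) \<theta>"
  using cong by (simp add: frame_congruence_def)

lemma theta_carrier: "(a, b) \<in> \<theta> \<Longrightarrow> a \<in> carrier L \<and> b \<in> carrier L"
  using equiv_theta by (auto simp: equiv_def)

lemma theta_refl: "a \<in> carrier L \<Longrightarrow> (a, a) \<in> \<theta>"
  using equiv_theta by (auto simp: equiv_def refl_on_def)

lemma theta_sym: "(a, b) \<in> \<theta> \<Longrightarrow> (b, a) \<in> \<theta>"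
  using equiv_theta by (auto simp: equiv_def sym_def)

lemma theta_trans: "(a, b) \<in> \<theta> \<Longrightarrow> (b, c) \<in> \<theta> \<Longrightarrow> (a, c) \<in> \<theta>"
  using equiv_theta unfolding equiv_def trans_def by blast

lemma theta_meet: "(a, b) \<in> \<theta> \<Longrightarrow> (c, d) \<in> \<theta> \<Longrightarrow> (a \<sqinter> c, b \<sqinter> d) \<in> \<theta>"
  using cong unfolding frame_congruence_def by blast

lemma theta_sup: "T \<subseteq> \<theta> \<Longrightarrow> (\<Squnion>(fst ` T), \<Squnion>(snd ` T)) \<in> \<theta>"
  using cong unfolding frame_congruence_def by blast

lemma quotient_class_eq_iff:
  "\<lbrakk>a \<in> carrier L; b \<in> carrier L\<rbrakk> \<Longrightarrow> cl a = cl b \<longleftrightarrow> (a, b) \<in> \<theta>"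
  using equiv_theta by (simp add: eq_equiv_class_iff)

lemma quotient_carrier: "carrier Q = cl ` carrier L"
  by (auto simp: frame_quotient_def quotient_def)

lemma quotient_le_iff:
  assumes a: "a \<in> carrier L" and b: "b \<in> carrier L"
  shows "cl a \<sqsubseteq>\<^bsub>Q\<^esub> cl b \<longleftrightarrow> (a \<sqinter> b, a) \<in> \<theta>"
proof
  assume "cl a \<sqsubseteq>\<^bsub>Q\<^esub> cl b"
  then obtain a' b' where *: "(a, a') \<in> \<theta>" "(b, b') \<in> \<theta>" "a' \<sqsubseteq> b'"
    by (auto simp: frame_quotient_def)
  have "a' \<sqinter> b' = a'" using *(3) theta_carrier[OF *(1)] theta_carrier[OF *(2)]
    by (intro meetI_eq) auto
  then have "(a \<sqinter> b, a') \<in> \<theta>" using theta_meet[OF *(1,2)] by simp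
  then show "(a \<sqinter> b, a) \<in> \<theta>" using * theta_sym theta_trans by blast
next
  assume *: "(a \<sqinter> b, a) \<in> \<theta>"
  have "a \<sqinter> b \<in> cl a" "b \<in> cl b" "a \<sqinter> b \<sqsubseteq> b"
    using * theta_sym theta_refl a b by (auto simp: meet_right)
  then show "cl a \<sqsubseteq>\<^bsub>Q\<^esub> cl b" by (auto simp: frame_quotient_def)
qed

lemma quotient_leI:
  assumes "a \<in> carrier L" "b \<in> carrier L" "a \<sqsubseteq> b"
  shows "cl a \<sqsubseteq>\<^bsub>Q\<^esub> cl b"
  using assms theta_refl by (auto simp: frame_quotient_def)

lemma partial_order_quotient: "partial_order Q"
proof -
  have eqQ: "eq Q = (=)" by (simp add: frame_quotient_def)
  have anti: "x = y" if xy: "x \<sqsubseteq>\<^bsub>Q\<^esub> y" "y \<sqsubseteq>\<^bsub>Q\<^esub> x" "x \<in> carrier Q" "y \<in> carrier Q" for x y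
  proof -
    obtain a b where ab: "a \<in> carrier L" "b \<in> carrier L" "x = cl a" "y = cl b"
      using xy by (auto simp: quotient_carrier)
    then have "(a \<sqinter> b, a) \<in> \<theta>" "(b \<sqinter> a, b) \<in> \<theta>"
      using xy quotient_le_iff by auto
    then have "(a \<sqinter> b, a) \<in> \<theta>" "(a \<sqinter> b, b) \<in> \<theta>"
      by (simp_all add: meet_comm[of _ b a])
    then show ?thesis using ab theta_sym theta_trans quotient_class_eq_iff by blast
  qed
  have trans: "x \<sqsubseteq>\<^bsub>Q\<^esub> z" if xyz: "x \<sqsubseteq>\<^bsub>Q\<^esub> y" "y \<sqsubseteq>\<^bsub>Q\<^esub> z"
      "x \<in> carrier Q" "y \<in> carrier Q" "z \<in> carrier Q" for x y z
  proof -
    obtain a b c where abc: "a \<in> carrier L" "b \<in> carrier L" "c \<in> carrier L"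
        "x = cl a" "y = cl b" "z = cl c"
      using xyz by (auto simp: quotient_carrier)
    then have ab: "(a \<sqinter> b, a) \<in> \<theta>" and bc: "(b \<sqinter> c, b) \<in> \<theta>"
      using xyz quotient_le_iff by auto
    have 1: "(a \<sqinter> (b \<sqinter> c), a \<sqinter> b) \<in> \<theta>" by (rule theta_meet[OF theta_refl[OF abc(1)] bc])
    have "((a \<sqinter> b) \<sqinter> c, a \<sqinter> c) \<in> \<theta>" by (rule theta_meet[OF ab theta_refl[OF abc(3)]])
    then have 2: "(a \<sqinter> (b \<sqinter> c), a \<sqinter> c) \<in> \<theta>" using abc by (simp add: meet_assoc)
    have "(a \<sqinter> c, a) \<in> \<theta>" by (rule theta_trans[OF theta_sym[OF 2] theta_trans[OF 1 ab]])
    then show ?thesis unfolding abc(4,6) quotient_le_iff[OF abc(1,3)] .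
  qed
  have refl: "x \<sqsubseteq>\<^bsub>Q\<^esub> x" if "x \<in> carrier Q" for x
    using that quotient_leI by (auto simp: quotient_carrier)
  show ?thesis
    by unfold_locales (use eqQ anti trans refl in \<open>auto\<close>)
qed

lemma quotient_is_lub:
  assumes T: "T \<subseteq> carrier L"
  shows "is_lub Q (cl (\<Squnion>T)) (cl ` T)"
proof (rule least_UpperI)
  show "cl ` T \<subseteq> carrier Q" "cl (\<Squnion>T) \<in> carrier Q" using T by (auto simp: quotient_carrier)
  show "x \<sqsubseteq>\<^bsub>Q\<^esub> cl (\<Squnion>T)" if "x \<in> cl ` T" for x
    using that T by (auto intro!: quotient_leI sup_upper)
  fix y assume y: "y \<in> Upper Q (cl ` T)"
  then obtain b where b: "b \<in> carrier L" "y = cl b" by (auto simp: Upper_def quotient_carrier)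
  have *: "(b \<sqinter> t, t) \<in> \<theta>" if "t \<in> T" for t
  proof -
    have "cl t \<sqsubseteq>\<^bsub>Q\<^esub> cl b"
      using y b that T by (auto simp: Upper_def quotient_carrier)
    then have "(t \<sqinter> b, t) \<in> \<theta>" using quotient_le_iff b that T by auto
    then show ?thesis by (simp add: meet_comm[of _ b t])
  qed
  have "(\<Squnion>(fst ` (\<lambda>t. (b \<sqinter> t, t)) ` T), \<Squnion>(snd ` (\<lambda>t. (b \<sqinter> t, t)) ` T)) \<in> \<theta>"
    using * by (intro theta_sup) auto
  then have "(b \<sqinter> \<Squnion>T, \<Squnion>T) \<in> \<theta>"
    by (simp add: image_image meet_sup_distrib[OF b(1) T])
  then show "cl (\<Squnion>T) \<sqsubseteq>\<^bsub>Q\<^esub> y"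
    using b T by (simp add: quotient_le_iff meet_comm[of _ b])
qed

lemma quotient_set_image: "A \<subseteq> carrier Q \<Longrightarrow> \<exists>T\<subseteq>carrier L. A = cl ` T"
  by (simp add: quotient_carrier subset_image_iff)

lemma complete_lattice_quotient: "complete_lattice Q"
proof (rule partial_order.complete_lattice_from_sups[OF partial_order_quotient])
  fix A assume "A \<subseteq> carrier Q"
  then obtain T where "T \<subseteq> carrier L" "A = cl ` T" using quotient_set_image by blast
  then show "\<exists>s. is_lub Q s A" using quotient_is_lub by blast
qed

lemma quotient_sup:
  assumes T: "T \<subseteq> carrier L"
  shows "\<Squnion>\<^bsub>Q\<^esub>(cl ` T) = cl (\<Squnion>T)"
proof (rule complete_lattice.supI_eq[OF complete_lattice_quotient])
  note lub = quotient_is_lub[OF T]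
  show c: "cl ` T \<subseteq> carrier Q" "cl (\<Squnion>T) \<in> carrier Q" using T by (auto simp: quotient_carrier)
  show "x \<sqsubseteq>\<^bsub>Q\<^esub> cl (\<Squnion>T)" if "x \<in> cl ` T" for x
    using least_Upper_above[OF lub that c(1)] .
  show "cl (\<Squnion>T) \<sqsubseteq>\<^bsub>Q\<^esub> y" if "y \<in> carrier Q" "\<And>x. x \<in> cl ` T \<Longrightarrow> x \<sqsubseteq>\<^bsub>Q\<^esub> y" for y
    using least_le[OF lub, of y] that by (auto simp: Upper_def)
qed

lemma quotient_meet:
  assumes a: "a \<in> carrier L" and b: "b \<in> carrier L"
  shows "cl a \<sqinter>\<^bsub>Q\<^esub> cl b = cl (a \<sqinter> b)"
proof (rule complete_lattice.meetI_eq[OF complete_lattice_quotient])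
  show "cl a \<in> carrier Q" "cl b \<in> carrier Q" "cl (a \<sqinter> b) \<in> carrier Q"
    using a b by (auto simp: quotient_carrier)
  show "cl (a \<sqinter> b) \<sqsubseteq>\<^bsub>Q\<^esub> cl a" "cl (a \<sqinter> b) \<sqsubseteq>\<^bsub>Q\<^esub> cl b"
    using a b by (auto intro!: quotient_leI simp: meet_left meet_right)
  fix y assume y: "y \<in> carrier Q" "y \<sqsubseteq>\<^bsub>Q\<^esub> cl a" "y \<sqsubseteq>\<^bsub>Q\<^esub> cl b"
  then obtain c where c: "c \<in> carrier L" "y = cl c" by (auto simp: quotient_carrier)
  have ca: "(c \<sqinter> a, c) \<in> \<theta>" and cb: "(c \<sqinter> b, c) \<in> \<theta>" using y c a b quotient_le_iff by auto
  have "((c \<sqinter> a) \<sqinter> b, c \<sqinter> b) \<in> \<theta>" using theta_meet[OF ca theta_refl[OF b]] .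
  then have "(c \<sqinter> (a \<sqinter> b), c) \<in> \<theta>" using theta_trans[OF _ cb] a b c by (simp add: meet_assoc)
  then show "y \<sqsubseteq>\<^bsub>Q\<^esub> cl (a \<sqinter> b)" using quotient_le_iff a b c by simp
qed

lemma quotient_top: "\<top>\<^bsub>Q\<^esub> = cl \<top>"
  by (rule complete_lattice.topI_eq[OF complete_lattice_quotient])
     (auto simp: quotient_carrier intro!: quotient_leI)

theorem frame_hom_quotient: "frame_hom L Q (\<lambda>a. \<theta> `` {a})"
  unfolding frame_hom_def
  by (auto simp: quotient_carrier quotient_top quotient_meet quotient_sup)

theorem frame_frame_quotient: "frame Q"
proof (rule frame.intro[OF complete_lattice_quotient], unfold_locales)
  fix x S assume x: "x \<in> carrier Q" and S: "S \<subseteq> carrier Q"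
  obtain a where a: "a \<in> carrier L" "x = cl a" using x by (auto simp: quotient_carrier)
  obtain T where T: "T \<subseteq> carrier L" "S = cl ` T" using quotient_set_image[OF S] by blast
  have im: "(\<lambda>s. x \<sqinter>\<^bsub>Q\<^esub> s) ` S = cl ` (\<lambda>t. a \<sqinter> t) ` T"
    unfolding T(2) a(2) image_image
    using a T by (intro image_cong) (auto simp: quotient_meet subset_iff)
  have aT: "(\<lambda>t. a \<sqinter> t) ` T \<subseteq> carrier L" using a T by auto
  have "x \<sqinter>\<^bsub>Q\<^esub> \<Squnion>\<^bsub>Q\<^esub>S = cl (a \<sqinter> \<Squnion>T)"
    unfolding T(2) a(2) using a T by (simp add: quotient_sup quotient_meet)
  also have "\<dots> = \<Squnion>\<^bsub>Q\<^esub>((\<lambda>s. x \<sqinter>\<^bsub>Q\<^esub> s) ` S)"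
    unfolding im quotient_sup[OF aT] meet_sup_distrib[OF a(1) T(1)] ..
  finally show "x \<sqinter>\<^bsub>Q\<^esub> \<Squnion>\<^bsub>Q\<^esub>S = \<Squnion>\<^bsub>Q\<^esub>((\<lambda>s. x \<sqinter>\<^bsub>Q\<^esub> s) ` S)" .
qed

end

end

end

theory Submission
  imports Defs
begin

text \<open>
  Write \<open>L i\<close> as a quotient \<open>q i\<close> of a free frame by countably many relations, and let \<open>x\<close> lie in a
  Scott open set \<open>H\<close> of the product. Every element of a free frame is a directed join of finitely
  generated ones, so some finite set \<open>E 0\<close> of generators below \<open>x\<close> already has its value in \<open>H\<close>.
  A relation \<open>V = U\<close> of \<open>L i\<close> permits replacing each generator lying in \<open>V\<close> by its meet with \<open>U\<close>
  without changing the value, after which finitely many generators suffice again. Only the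
  countably many relations at the finitely many indices occurring in \<open>E 0\<close> matter, so one can treat
  each of them infinitely often along a decreasing sequence \<open>E n\<close>. The elements of the \<open>i\<close>-th free
  frame above some \<open>E n\<close> then form a Scott open filter that respects the relations, hence the whole
  congruence they generate. Its image in \<open>L i\<close> is Scott open, and the box of these images contains
  \<open>x\<close> and lies in \<open>H\<close>.
\<close>

section \<open>Compact elements and Scott open sets of a free frame\<close>

section \<open>Finitary upper sets in the free frame\<close>

text \<open>A finite set \<open>F\<close> stands for the meet of its generators, so this is the join
  of the meets coded by \<open>S\<close>. The spans of finite \<open>S\<close> are exactly the
  compact elements of the free frame.\<close>

definition free_frame_span :: "'x set \<Rightarrow> 'x set set \<Rightarrow> 'x set set"
  where "free_frame_span X S = {G \<in> Fpow X. \<exists>F\<in>S. F \<subseteq> G}"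

lemma free_frame_carrierD:
  assumes "U \<in> carrier (free_frame X)"
  shows "U \<subseteq> Fpow X" "\<And>F G. \<lbrakk>F \<in> U; G \<in> Fpow X; F \<subseteq> G\<rbrakk> \<Longrightarrow> G \<in> U"
  using assms unfolding free_frame_def by auto

lemma free_frame_carrier_Un:
  "\<lbrakk>U \<in> carrier (free_frame X); V \<in> carrier (free_frame X)\<rbrakk> \<Longrightarrow> U \<union> V \<in> carrier (free_frame X)"
  using free_frame_carrier_Union[of "{U, V}"] by simp

lemma free_frame_span_closed: "free_frame_span X S \<in> carrier (free_frame X)"
  unfolding free_frame_span_def free_frame_def by auto

lemma free_frame_span_least:
  assumes "A \<in> carrier (free_frame X)" "S \<subseteq> A"
  shows "free_frame_span X S \<subseteq> A"
proof
  fix G assume "G \<in> free_frame_span X S"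
  then obtain F where "F \<in> S" "G \<in> Fpow X" "F \<subseteq> G" unfolding free_frame_span_def by blast
  then show "G \<in> A" using free_frame_carrierD(2)[OF assms(1)] assms(2) by blast
qed

lemma free_frame_span_upper: "S \<subseteq> Fpow X \<Longrightarrow> S \<subseteq> free_frame_span X S"
  unfolding free_frame_span_def by auto

lemma free_frame_span_mono: "S \<subseteq> T \<Longrightarrow> free_frame_span X S \<subseteq> free_frame_span X T"
  unfolding free_frame_span_def by auto

text \<open>These are the Scott open subsets of the free frame. Asking for finite subfamilies of
  arbitrary joins is equivalent to the directed formulation, because the finite subjoins of
  \<open>T\<close> form a directed set.\<close>

definition finitary_upset :: "'x set \<Rightarrow> 'x set set set \<Rightarrow> bool"
  where "finitary_upset X \<G> \<longleftrightarrow> \<G> \<subseteq> carrier (free_frame X) \<and>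
    (\<forall>A\<in>\<G>. \<forall>B\<in>carrier (free_frame X). A \<subseteq> B \<longrightarrow> B \<in> \<G>) \<and>
    (\<forall>T\<subseteq>carrier (free_frame X). \<Union>T \<in> \<G> \<longrightarrow> (\<exists>S\<subseteq>T. finite S \<and> \<Union>S \<in> \<G>))"

lemma finitary_upsetD:
  assumes "finitary_upset X \<G>"
  shows "\<G> \<subseteq> carrier (free_frame X)"
    "\<And>A B. \<lbrakk>A \<in> \<G>; B \<in> carrier (free_frame X); A \<subseteq> B\<rbrakk> \<Longrightarrow> B \<in> \<G>"
    "\<And>T. \<lbrakk>T \<subseteq> carrier (free_frame X); \<Union>T \<in> \<G>\<rbrakk> \<Longrightarrow> \<exists>S\<subseteq>T. finite S \<and> \<Union>S \<in> \<G>"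
  using assms unfolding finitary_upset_def by auto

text \<open>Each \<open>E k\<close> is finite, so finitely many members of \<open>T\<close> already
  cover it, and their union then contains its span.\<close>

lemma finitary_upset_span_chain:
  assumes fin: "\<And>k::nat. finite (E k)" and sub: "\<And>k. E k \<subseteq> Fpow X"
  shows "finitary_upset X {A \<in> carrier (free_frame X). \<exists>k. free_frame_span X (E k) \<subseteq> A}"
  unfolding finitary_upset_def
proof (intro conjI ballI allI impI)
  fix T assume T: "T \<subseteq> carrier (free_frame X)"
    and "\<Union>T \<in> {A \<in> carrier (free_frame X). \<exists>k. free_frame_span X (E k) \<subseteq> A}"
  then obtain k where k: "free_frame_span X (E k) \<subseteq> \<Union>T" by blast
  then have "E k \<subseteq> \<Union>T" using free_frame_span_upper[OF sub] by blast
  then obtain S where S: "finite S" "S \<subseteq> T" "E k \<subseteq> \<Union>S"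
    using finite_subset_Union[OF fin] by metis
  have US: "\<Union>S \<in> carrier (free_frame X)" using S T by (intro free_frame_carrier_Union) blast
  then have "free_frame_span X (E k) \<subseteq> \<Union>S" using S(3) by (rule free_frame_span_least)
  then have "\<Union>S \<in> {A \<in> carrier (free_frame X). \<exists>k. free_frame_span X (E k) \<subseteq> A}"
    using US by (intro CollectI conjI exI)
  then show "\<exists>S\<subseteq>T. finite S \<and> \<Union>S \<in> {A \<in> carrier (free_frame X). \<exists>k. free_frame_span X (E k) \<subseteq> A}"
    using S(1,2) by (intro exI[of _ S] conjI)
qed auto

section \<open>The syntactic congruence of a Scott open set\<close>

text \<open>
  If \<open>\<G>\<close> is invariant under generating relations in the contexts \<open>- \<inter> C \<union> D\<close>, then these relations
  lie in the following congruence, so \<open>\<G>\<close> is invariant under the congruence they generate.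
\<close>

definition separation_congruence :: "'x set \<Rightarrow> 'x set set set \<Rightarrow> ('x set set \<times> 'x set set) set"
  where "separation_congruence X \<G> =
    {(A, B). A \<in> carrier (free_frame X) \<and> B \<in> carrier (free_frame X) \<and>
      (\<forall>C\<in>carrier (free_frame X). \<forall>D\<in>carrier (free_frame X). A \<inter> C \<union> D \<in> \<G> \<longleftrightarrow> B \<inter> C \<union> D \<in> \<G>)}"

text \<open>Since \<G> is finitary, finitely many pairs of \<open>T\<close> suffice, and these can
  be exchanged one at a time while all the others are absorbed into the context
  \<open>D\<close>.\<close>

lemma separation_congruence_sup:
  assumes \<G>: "finitary_upset X \<G>" and T: "T \<subseteq> separation_congruence X \<G>"
    and C: "C \<in> carrier (free_frame X)" and D: "D \<in> carrier (free_frame X)"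
    and mem: "\<Union>(fst ` T) \<inter> C \<union> D \<in> \<G>"
  shows "\<Union>(snd ` T) \<inter> C \<union> D \<in> \<G>"
proof -
  note c = free_frame_carrier_Un free_frame_carrier_Int
  have Tc: "a \<in> carrier (free_frame X)" "b \<in> carrier (free_frame X)"
    and Tsep: "\<And>C D. \<lbrakk>C \<in> carrier (free_frame X); D \<in> carrier (free_frame X); a \<inter> C \<union> D \<in> \<G>\<rbrakk>
      \<Longrightarrow> b \<inter> C \<union> D \<in> \<G>" if "(a, b) \<in> T" for a b
    using T that unfolding separation_congruence_def by auto
  have Uc: "\<Union>(fst ` S) \<in> carrier (free_frame X)" "\<Union>(snd ` S) \<in> carrier (free_frame X)" if "S \<subseteq> T" for S
    using that Tc by (auto intro!: free_frame_carrier_Union)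
  \<comment> \<open>\<open>D'\<close> must vary in the induction: after \<open>a\<close> has been
    exchanged for \<open>b\<close>, the part \<open>b \<inter> C\<close> joins the context of the
    remaining pairs.\<close>
  have step: "\<Union>(snd ` S) \<inter> C \<union> D' \<in> \<G>"
    if "finite S" "S \<subseteq> T" "D' \<in> carrier (free_frame X)" "\<Union>(fst ` S) \<inter> C \<union> D' \<in> \<G>" for S D'
    using that
  proof (induction S arbitrary: D' rule: finite_induct)
    case (insert p S)
    obtain a b where p: "p = (a, b)" by (cases p)
    have ab: "(a, b) \<in> T" and ST: "S \<subseteq> T" using insert p by auto
    note [simp] = Tc[OF ab] Uc[OF ST] C \<open>D' \<in> carrier (free_frame X)\<close>
    have "a \<inter> C \<union> (\<Union>(fst ` S) \<inter> C \<union> D') \<in> \<G>"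
      using insert.prems(3) by (simp add: p Int_Un_distrib2 Un_assoc)
    then have "b \<inter> C \<union> (\<Union>(fst ` S) \<inter> C \<union> D') \<in> \<G>"
      by (rule Tsep[OF ab, rotated 2]) (simp_all add: c)
    then have "\<Union>(fst ` S) \<inter> C \<union> (b \<inter> C \<union> D') \<in> \<G>" by (simp add: Un_left_commute)
    then have "\<Union>(snd ` S) \<inter> C \<union> (b \<inter> C \<union> D') \<in> \<G>"
      by (intro insert.IH[OF ST]) (simp_all add: c)
    then show ?case by (simp add: p Int_Un_distrib2 Un_assoc Un_left_commute)
  qed simp
  \<comment> \<open>Distributing \<open>C\<close> over the join and adding \<open>D\<close> as one
    more member writes the whole expression as a single union, to which finitariness
    applies.\<close>
  define T' where "T' = (\<lambda>p. fst p \<inter> C) ` T \<union> {D}"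
  have "\<Union>T' = \<Union>(fst ` T) \<inter> C \<union> D" unfolding T'_def by auto
  moreover have "T' \<subseteq> carrier (free_frame X)"
    unfolding T'_def using Tc C D by (auto intro!: free_frame_carrier_Int)
  ultimately obtain S' where S': "S' \<subseteq> T'" "finite S'" "\<Union>S' \<in> \<G>"
    using finitary_upsetD(3)[OF \<G>] mem by metis
  \<comment> \<open>\<open>D\<close> may or may not have been selected; removing it leaves only
    members that come from pairs, and uniting with \<open>D\<close> afterwards only enlarges the
    set.\<close>
  have "finite (S' - {D})" "S' - {D} \<subseteq> (\<lambda>p. fst p \<inter> C) ` T" using S' unfolding T'_def by auto
  then obtain S where S: "S \<subseteq> T" "finite S" "S' - {D} = (\<lambda>p. fst p \<inter> C) ` S"
    by (meson finite_subset_image)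
  have "\<Union>S' \<subseteq> \<Union>(S' - {D}) \<union> D" by blast
  also have "\<dots> = \<Union>(fst ` S) \<inter> C \<union> D" unfolding S(3) by auto
  finally have "\<Union>(fst ` S) \<inter> C \<union> D \<in> \<G>"
    using finitary_upsetD(2)[OF \<G> S'(3)] Uc[OF S(1)] C D by (simp add: c)
  then have "\<Union>(snd ` S) \<inter> C \<union> D \<in> \<G>" using step S D by blast
  then show ?thesis
  proof (rule finitary_upsetD(2)[OF \<G>])
    show "\<Union>(snd ` T) \<inter> C \<union> D \<in> carrier (free_frame X)" using Uc[of T] C D by (simp add: c)
    show "\<Union>(snd ` S) \<inter> C \<union> D \<subseteq> \<Union>(snd ` T) \<inter> C \<union> D" using S(1) by blast
  qed
qed

text \<open>For meets, one factor is exchanged at a time while the other is moved into the context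
  \<open>C\<close>. For joins, the previous lemma is applied to \<open>T\<close> and to its
  converse.\<close>

lemma frame_congruence_separation:
  assumes \<G>: "finitary_upset X \<G>"
  shows "frame_congruence (free_frame X) (separation_congruence X \<G>)"
  unfolding frame_congruence_def
proof (intro conjI allI impI)
  show "equiv (carrier (free_frame X)) (separation_congruence X \<G>)"
  proof (rule equivI)
    show "separation_congruence X \<G> \<subseteq> carrier (free_frame X) \<times> carrier (free_frame X)"
      by (auto simp: separation_congruence_def)
    show "refl_on (carrier (free_frame X)) (separation_congruence X \<G>)"
      by (simp add: refl_on_def separation_congruence_def)
    show "sym (separation_congruence X \<G>)"
      by (simp add: sym_def separation_congruence_def)
    show "trans (separation_congruence X \<G>)"
      by (simp add: trans_def separation_congruence_def)
  qed
next
  fix a b c d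
  assume ab: "(a, b) \<in> separation_congruence X \<G>" and cd: "(c, d) \<in> separation_congruence X \<G>"
  then have car: "a \<in> carrier (free_frame X)" "b \<in> carrier (free_frame X)"
    "c \<in> carrier (free_frame X)" "d \<in> carrier (free_frame X)"
    by (auto simp: separation_congruence_def)
  have "a \<inter> c \<inter> C \<union> D \<in> \<G> \<longleftrightarrow> b \<inter> d \<inter> C \<union> D \<in> \<G>"
    if C: "C \<in> carrier (free_frame X)" and D: "D \<in> carrier (free_frame X)" for C D
  proof -
    have "a \<inter> (c \<inter> C) \<union> D \<in> \<G> \<longleftrightarrow> b \<inter> (c \<inter> C) \<union> D \<in> \<G>"
      using ab D free_frame_carrier_Int[OF car(3) C] by (simp add: separation_congruence_def)
    also have "\<dots> \<longleftrightarrow> c \<inter> (b \<inter> C) \<union> D \<in> \<G>" by (simp add: Int_left_commute)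
    also have "\<dots> \<longleftrightarrow> d \<inter> (b \<inter> C) \<union> D \<in> \<G>"
      using cd D free_frame_carrier_Int[OF car(2) C] by (simp add: separation_congruence_def)
    finally show ?thesis by (simp add: Int_ac)
  qed
  then show "(a \<sqinter>\<^bsub>free_frame X\<^esub> c, b \<sqinter>\<^bsub>free_frame X\<^esub> d) \<in> separation_congruence X \<G>"
    using car by (simp add: free_frame_meet separation_congruence_def free_frame_carrier_Int)
next
  fix T assume T: "T \<subseteq> separation_congruence X \<G>"
  have swap: "prod.swap ` T \<subseteq> separation_congruence X \<G>"
    using T by (auto simp: separation_congruence_def)
  have car: "fst ` T \<subseteq> carrier (free_frame X)" "snd ` T \<subseteq> carrier (free_frame X)"
    using T by (auto simp: separation_congruence_def)
  have "\<Union>(fst ` T) \<inter> C \<union> D \<in> \<G> \<longleftrightarrow> \<Union>(snd ` T) \<inter> C \<union> D \<in> \<G>"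
    if "C \<in> carrier (free_frame X)" "D \<in> carrier (free_frame X)" for C D
    using separation_congruence_sup[OF \<G> T that] separation_congruence_sup[OF \<G> swap that]
    by (auto simp: image_image)
  then show "(\<Squnion>\<^bsub>free_frame X\<^esub> (fst ` T), \<Squnion>\<^bsub>free_frame X\<^esub> (snd ` T)) \<in> separation_congruence X \<G>"
    unfolding free_frame_sup[OF car(1)] free_frame_sup[OF car(2)]
    using free_frame_carrier_Union[OF car(1)] free_frame_carrier_Union[OF car(2)]
    by (simp add: separation_congruence_def)
qed

section \<open>Countable presentations as quotient maps from free frames\<close>

section \<open>Presentations\<close>

text \<open>Together, \<open>relation\<close> and \<open>kernel_least\<close> say that the kernel of
  \<open>q\<close> is the congruence generated by \<open>R\<close>. With \<open>R\<close> symmetric,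
  invariance under a relation has to be checked in one direction only.\<close>

locale frame_presentation = frame L for L (structure) +
  fixes X :: "'x set" and R :: "('x set set \<times> 'x set set) set" and q :: "'x set set \<Rightarrow> 'a"
  assumes hom: "frame_hom (free_frame X) L q"
    and surj: "q ` carrier (free_frame X) = carrier L"
    and R_closed: "R \<subseteq> carrier (free_frame X) \<times> carrier (free_frame X)"
    and R_sym: "sym R"
    and R_countable: "countable R"
    and relation: "(U, V) \<in> R \<Longrightarrow> q U = q V"
    and kernel_least: "\<lbrakk>frame_congruence (free_frame X) \<theta>; R \<subseteq> \<theta>; A \<in> carrier (free_frame X);
      B \<in> carrier (free_frame X); q A = q B\<rbrakk> \<Longrightarrow> (A, B) \<in> \<theta>"
begin

lemma q_closed: "A \<in> carrier (free_frame X) \<Longrightarrow> q A \<in> carrier L"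
  using surj by blast

lemma q_preimage: "a \<in> carrier L \<Longrightarrow> \<exists>A. A \<in> carrier (free_frame X) \<and> q A = a"
  by (auto simp flip: surj)

lemma q_Int: "\<lbrakk>A \<in> carrier (free_frame X); B \<in> carrier (free_frame X)\<rbrakk> \<Longrightarrow> q (A \<inter> B) = q A \<sqinter> q B"
  using hom by (simp add: frame_hom_def flip: free_frame_meet)

lemma q_Union: "S \<subseteq> carrier (free_frame X) \<Longrightarrow> q (\<Union>S) = \<Squnion>(q ` S)"
  using hom by (simp add: frame_hom_def flip: free_frame_sup)

lemma q_mono:
  assumes "A \<in> carrier (free_frame X)" "B \<in> carrier (free_frame X)" "A \<subseteq> B"
  shows "q A \<sqsubseteq> q B"
proof -
  have "q A = q A \<sqinter> q B" using q_Int[OF assms(1,2)] assms(3) by (simp add: inf_absorb1)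
  then show ?thesis using meet_right[OF q_closed[OF assms(1)] q_closed[OF assms(2)]] by simp
qed

lemma q_Union_le:
  assumes "S \<subseteq> carrier (free_frame X)" "y \<in> carrier L" "\<And>A. A \<in> S \<Longrightarrow> q A \<sqsubseteq> y"
  shows "q (\<Union>S) \<sqsubseteq> y"
  unfolding q_Union[OF assms(1)]
  using assms q_closed by (intro sup_least) (auto simp: Upper_def)

text \<open>In \<open>L\<close>, \<open>q A\<close> lies below \<open>q V = q U\<close>, so meeting
  with \<open>U\<close> costs nothing. This is what makes the replacement of generators
  possible.\<close>

lemma q_relation_below:
  assumes "(V, U) \<in> R" "A \<in> carrier (free_frame X)" "A \<subseteq> V"
  shows "q (A \<inter> U) = q A"
proof -
  have UV: "U \<in> carrier (free_frame X)" "V \<in> carrier (free_frame X)" using assms(1) R_closed by auto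
  have "q (A \<inter> U) = q (A \<inter> V)" using relation[OF assms(1)] q_Int[OF assms(2)] UV by simp
  then show ?thesis using assms(3) by (simp add: inf_absorb1)
qed

text \<open>Since \<G> is saturated for the kernel of \<open>q\<close>, membership of a value in the
  image can be tested on any preimage. A directed supremum is then the value of a union of
  preimages, where finitariness applies.\<close>

lemma scott_open_image:
  assumes \<G>: "finitary_upset X \<G>"
    and sat: "\<And>A B. \<lbrakk>A \<in> \<G>; B \<in> carrier (free_frame X); q A = q B\<rbrakk> \<Longrightarrow> B \<in> \<G>"
  shows "scott_open L (q ` \<G>)"
proof -
  have up: "b \<in> q ` \<G>" if mem: "A \<in> \<G>" and b: "b \<in> carrier L" and le: "q A \<sqsubseteq> b" for A b
  proof -
    have A: "A \<in> carrier (free_frame X)" using \<G> mem finitary_upsetD(1) by blast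
    obtain B where B: "B \<in> carrier (free_frame X)" "q B = b"
      using q_preimage[OF b] by auto
    \<comment> \<open>Joining \<open>A\<close> to an arbitrary preimage of \<open>b\<close> gives a
      preimage of \<open>b\<close> that lies above \<open>A\<close>.\<close>
    have AB: "A \<union> B \<in> carrier (free_frame X)" using A B free_frame_carrier_Un by blast
    then have "A \<union> B \<in> \<G>" using finitary_upsetD(2)[OF \<G> mem] by blast
    moreover have "q (\<Union>{A, B}) \<sqsubseteq> b" using A B b le by (intro q_Union_le) auto
    then have "q (A \<union> B) = b"
      using q_mono[OF B(1) AB] B(2) b q_closed[OF AB] by (simp add: le_antisym)
    ultimately show ?thesis by blast
  qed
  show ?thesis
    unfolding scott_open_def
  proof (intro conjI ballI allI impI)
    show "q ` \<G> \<subseteq> carrier L" using finitary_upsetD(1)[OF \<G>] q_closed by blast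
  next
    fix x y assume "x \<in> q ` \<G>" "y \<in> carrier L" "x \<sqsubseteq> y"
    then show "y \<in> q ` \<G>" using up by blast
  next
    fix D s assume D: "directed_in L D" and s: "is_lub L s D" "s \<in> q ` \<G>"
    have DL: "D \<subseteq> carrier L" using D by (simp add: directed_in_def)
    obtain A where A: "A \<in> \<G>" "s = q A" using s(2) by blast
    have "\<forall>d\<in>D. \<exists>B. B \<in> carrier (free_frame X) \<and> q B = d" using q_preimage DL by auto
    then obtain B where B: "\<And>d. d \<in> D \<Longrightarrow> B d \<in> carrier (free_frame X)" "\<And>d. d \<in> D \<Longrightarrow> q (B d) = d"
      by metis
    have BD: "B ` D \<subseteq> carrier (free_frame X)" using B by blast
    have "q ` B ` D = D" using B(2) by (auto simp: image_image)
    moreover have "\<Squnion>D = s"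
    proof (rule supI_eq[OF DL])
      show "s \<in> carrier L" using s(1) by (simp add: least_def Upper_def)
      show "x \<sqsubseteq> s" if "x \<in> D" for x using least_Upper_above[OF s(1) that DL] .
      show "s \<sqsubseteq> y" if "y \<in> carrier L" "\<And>x. x \<in> D \<Longrightarrow> x \<sqsubseteq> y" for y
        using least_le[OF s(1), of y] that by (auto simp: Upper_def)
    qed
    ultimately have "q (\<Union>(B ` D)) = q A" using q_Union[OF BD] A(2) by simp
    \<comment> \<open>Saturation enters here: this union and \<open>A\<close> both have the value
      \<open>s\<close>.\<close>
    then have "\<Union>(B ` D) \<in> \<G>"
      using sat[OF A(1)] free_frame_carrier_Union[OF BD] by simp
    then obtain S where S: "S \<subseteq> B ` D" "finite S" "\<Union>S \<in> \<G>"
      using finitary_upsetD(3)[OF \<G> BD] by blast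
    then obtain D' where D': "D' \<subseteq> D" "finite D'" "S = B ` D'" by (meson finite_subset_image)
    have "\<exists>z\<in>D. \<forall>d\<in>D'. d \<sqsubseteq> z" using D'(2,1)
    proof (induction D' rule: finite_induct)
      case empty
      then show ?case using D by (auto simp: directed_in_def)
    next
      case (insert d D')
      then obtain z where z: "z \<in> D" "\<forall>d\<in>D'. d \<sqsubseteq> z" by auto
      obtain w where w: "w \<in> D" "d \<sqsubseteq> w" "z \<sqsubseteq> w"
        using D insert.prems z(1) unfolding directed_in_def by blast
      have "e \<sqsubseteq> w" if "e \<in> D'" for e
        using that z w insert.prems DL by (meson insert_subset le_trans subsetD)
      then show ?case using w by auto
    qed
    then obtain z where z: "z \<in> D" "\<forall>d\<in>D'. d \<sqsubseteq> z" by blast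
    \<comment> \<open>The chosen preimage of \<open>z\<close> need not contain the finite union; it
      is enough that \<open>z\<close> lies above its value, by \<open>up\<close>.\<close>
    have "q (\<Union>S) \<sqsubseteq> z"
      using D' z B DL by (intro q_Union_le) auto
    then have "z \<in> q ` \<G>" using up[OF S(3)] z(1) DL by blast
    then show "D \<inter> q ` \<G> \<noteq> {}" using z(1) by blast
  qed
qed

end

text \<open>\<open>q\<close> is the projection to classes followed by the inverse of the given
  isomorphism. Adding the converse relations keeps the set countable and does not change the
  generated congruence.\<close>

lemma frame_presentation_exists:
  fixes L :: "'a gorder"
  assumes L: "frame L" and cp: "countably_presented L"
  shows "\<exists>(X :: nat set) R q. frame_presentation L X R q"
proof -
  interpret frame L by (rule L)
  obtain X :: "nat set" and R where R: "R \<subseteq> carrier (free_frame X) \<times> carrier (free_frame X)"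
      "countable R" and iso: "frame_isomorphic L
         (frame_quotient (free_frame X) (generated_congruence (free_frame X) R))"
    using cp unfolding countably_presented_def by blast
  define \<theta> where "\<theta> = generated_congruence (free_frame X) R"
  interpret F: frame "free_frame X" by (rule frame_free_frame)
  have cong: "frame_congruence (free_frame X) \<theta>" and R\<theta>: "R \<subseteq> \<theta>"
    unfolding \<theta>_def using F.frame_congruence_generated[OF R(1)] by auto
  define Q where "Q = frame_quotient (free_frame X) \<theta>"
  obtain h where h: "frame_hom L Q h" and bij: "bij_betw h (carrier L) (carrier Q)"
    using iso unfolding frame_isomorphic_def Q_def \<theta>_def by blast
  define q where "q A = inv_into (carrier L) h (\<theta> `` {A})" for A
  have cl: "frame_hom (free_frame X) Q (\<lambda>A. \<theta> `` {A})"
    unfolding Q_def by (rule F.frame_hom_quotient[OF cong])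
  have carQ: "carrier Q = (\<lambda>A. \<theta> `` {A}) ` carrier (free_frame X)"
    unfolding Q_def by (rule F.quotient_carrier[OF cong])
  have hq: "h (q A) = \<theta> `` {A}" if "A \<in> carrier (free_frame X)" for A
    unfolding q_def using that carQ bij by (intro bij_betw_inv_into_right) auto
  have qc: "q A \<in> carrier L" if "A \<in> carrier (free_frame X)" for A
    unfolding q_def using that carQ bij bij_betw_imp_surj_on inv_into_into by (metis imageI)
  \<comment> \<open>As \<open>h\<close> is injective, an equation for \<open>q\<close> may be
    checked after applying \<open>h\<close>, where it becomes a property of the projection.\<close>
  have qI: "q A = a" if "A \<in> carrier (free_frame X)" "a \<in> carrier L" "h a = \<theta> `` {A}" for A a
    using that bij hq[OF that(1)] qc[OF that(1)] by (metis bij_betw_imp_inj_on inj_onD)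
  have hom: "frame_hom (free_frame X) L q"
    unfolding frame_hom_def
  proof (intro conjI ballI allI impI)
    show "q \<in> carrier (free_frame X) \<rightarrow> carrier L" using qc by blast
    show "q \<top>\<^bsub>free_frame X\<^esub> = \<top>\<^bsub>L\<^esub>" using h cl by (intro qI) (auto simp: frame_hom_def)
    show "q (a \<sqinter>\<^bsub>free_frame X\<^esub> b) = q a \<sqinter>\<^bsub>L\<^esub> q b"
      if "a \<in> carrier (free_frame X)" "b \<in> carrier (free_frame X)" for a b
      using h cl that by (intro qI) (auto simp: frame_hom_def qc hq)
    show "q (\<Squnion>\<^bsub>free_frame X\<^esub>S) = \<Squnion>\<^bsub>L\<^esub>(q ` S)" if S: "S \<subseteq> carrier (free_frame X)" for S
    proof (rule qI)
      show "\<Squnion>\<^bsub>free_frame X\<^esub>S \<in> carrier (free_frame X)" "\<Squnion>\<^bsub>L\<^esub>(q ` S) \<in> carrier L"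
        using S qc by (auto intro!: sup_closed F.sup_closed)
      have "q ` S \<subseteq> carrier L" using S qc by blast
      then have "h (\<Squnion>\<^bsub>L\<^esub>(q ` S)) = \<Squnion>\<^bsub>Q\<^esub>(h ` q ` S)" using h by (simp add: frame_hom_def)
      also have "h ` q ` S = (\<lambda>A. \<theta> `` {A}) ` S"
        unfolding image_image using S hq by (intro image_cong) auto
      finally show "h (\<Squnion>\<^bsub>L\<^esub>(q ` S)) = \<theta> `` {\<Squnion>\<^bsub>free_frame X\<^esub>S}"
        using cl S by (simp add: frame_hom_def)
    qed
  qed
  have ker: "q A = q B \<longleftrightarrow> (A, B) \<in> \<theta>"
    if "A \<in> carrier (free_frame X)" "B \<in> carrier (free_frame X)" for A B
    using F.quotient_class_eq_iff[OF cong that] hq[OF that(1)] hq[OF that(2)]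
    by (metis q_def)
  have "frame_presentation L X (R \<union> R\<inverse>) q"
  proof (unfold_locales)
    show "frame_hom (free_frame X) L q" by (rule hom)
    show "q ` carrier (free_frame X) = carrier L"
    proof
      show "q ` carrier (free_frame X) \<subseteq> carrier L" using qc by blast
      show "carrier L \<subseteq> q ` carrier (free_frame X)"
      proof
        fix a assume a: "a \<in> carrier L"
        then have "h a \<in> carrier Q" using bij by (auto simp: bij_betw_def)
        then obtain A where "A \<in> carrier (free_frame X)" "h a = \<theta> `` {A}" using carQ by auto
        then show "a \<in> q ` carrier (free_frame X)" using qI a by blast
      qed
    qed
    show "R \<union> R\<inverse> \<subseteq> carrier (free_frame X) \<times> carrier (free_frame X)" using R(1) by auto
    show "sym (R \<union> R\<inverse>)" by (auto simp: sym_def)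
    have "countable (prod.swap ` R)" using R(2) by simp
    moreover have "prod.swap ` R = R\<inverse>" by force
    ultimately show "countable (R \<union> R\<inverse>)" using R(2) by simp
    show "q U = q V" if "(U, V) \<in> R \<union> R\<inverse>" for U V
    proof -
      have "q A = q B" if AB: "(A, B) \<in> R" for A B
      proof -
        have "A \<in> carrier (free_frame X)" "B \<in> carrier (free_frame X)" using AB R(1) by auto
        moreover have "(A, B) \<in> \<theta>" using AB R\<theta> by blast
        ultimately show ?thesis using ker by simp
      qed
      from this[of U V] this[of V U] show ?thesis using that by auto
    qed
    show "(A, B) \<in> \<theta>'"
      if "frame_congruence (free_frame X) \<theta>'" "R \<union> R\<inverse> \<subseteq> \<theta>'" "A \<in> carrier (free_frame X)"
        "B \<in> carrier (free_frame X)" "q A = q B" for \<theta>' A B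
    proof -
      have "(A, B) \<in> \<theta>" using ker[OF that(3,4)] that(5) by simp
      then show ?thesis using that(1,2) by (auto simp: \<theta>_def generated_congruence_def)
    qed
  qed
  then show ?thesis by blast
qed

section \<open>The product topology is contained in the Scott topology\<close>

section \<open>Scott open sets in a product\<close>

lemma product_order_carrier: "carrier (product_order I L) = (\<Pi>\<^sub>E i\<in>I. carrier (L i))"
  by (simp add: product_order_def)

lemma product_order_le: "f \<sqsubseteq>\<^bsub>product_order I L\<^esub> g \<longleftrightarrow> (\<forall>i\<in>I. f i \<sqsubseteq>\<^bsub>L i\<^esub> g i)"
  by (simp add: product_order_def)

lemma is_lubI:
  assumes "A \<subseteq> carrier P" "s \<in> carrier P" "\<And>x. x \<in> A \<Longrightarrow> x \<sqsubseteq>\<^bsub>P\<^esub> s"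
    "\<And>y. \<lbrakk>y \<in> carrier P; \<And>x. x \<in> A \<Longrightarrow> x \<sqsubseteq>\<^bsub>P\<^esub> y\<rbrakk> \<Longrightarrow> s \<sqsubseteq>\<^bsub>P\<^esub> y"
  shows "is_lub P s A"
proof -
  have "s \<sqsubseteq>\<^bsub>P\<^esub> y" if "y \<in> Upper P A" for y
    using that assms(1,4) by (simp add: Upper_def subset_iff)
  then show ?thesis using assms(1-3) by (auto simp: least_def Upper_def)
qed

text \<open>Replacing the coordinate \<open>s i\<close> by an upper bound \<open>y\<close> of the
  projections gives an upper bound of \<open>D\<close>, hence one above \<open>s\<close>.\<close>

lemma is_lub_product_component:
  assumes lub: "is_lub (product_order I L) s D" and D: "D \<subseteq> carrier (product_order I L)" and i: "i \<in> I"
  shows "is_lub (L i) (s i) ((\<lambda>f. f i) ` D)"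
proof -
  have sU: "s \<in> carrier (product_order I L)" "\<And>d. d \<in> D \<Longrightarrow> d \<sqsubseteq>\<^bsub>product_order I L\<^esub> s"
    using lub D unfolding least_def Upper_def by auto
  have sL: "\<And>y. \<lbrakk>y \<in> carrier (product_order I L); \<And>d. d \<in> D \<Longrightarrow> d \<sqsubseteq>\<^bsub>product_order I L\<^esub> y\<rbrakk>
      \<Longrightarrow> s \<sqsubseteq>\<^bsub>product_order I L\<^esub> y"
    using lub D unfolding least_def Upper_def by auto
  have "s i \<sqsubseteq>\<^bsub>L i\<^esub> y" if y: "y \<in> carrier (L i)" "\<And>d. d \<in> D \<Longrightarrow> d i \<sqsubseteq>\<^bsub>L i\<^esub> y" for y
  proof -
    have "s \<sqsubseteq>\<^bsub>product_order I L\<^esub> s(i := y)"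
    proof (rule sL)
      show "s(i := y) \<in> carrier (product_order I L)"
        using sU(1) y(1) i by (auto simp: product_order_carrier PiE_iff extensional_def)
      show "d \<sqsubseteq>\<^bsub>product_order I L\<^esub> s(i := y)" if "d \<in> D" for d
        using sU(2)[OF that] y(2)[OF that] by (auto simp: product_order_le)
    qed
    then show ?thesis using i by (auto simp: product_order_le dest!: bspec)
  qed
  then show ?thesis
    using sU D i by (intro is_lubI) (auto simp: product_order_carrier product_order_le)
qed

lemma directed_in_product_component:
  "\<lbrakk>directed_in (product_order I L) D; i \<in> I\<rbrakk> \<Longrightarrow> directed_in (L i) ((\<lambda>f. f i) ` D)"
  unfolding directed_in_def product_order_carrier product_order_le
  by (auto simp: PiE_iff subset_iff) blast

lemma directed_in_product_finite_upper_bound: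
  assumes D: "directed_in (product_order I L) D" and L: "\<And>i. i \<in> I \<Longrightarrow> partial_order (L i)"
    and S: "finite S" "S \<subseteq> D"
  shows "\<exists>z\<in>D. \<forall>d\<in>S. d \<sqsubseteq>\<^bsub>product_order I L\<^esub> z"
  using S
proof (induction S rule: finite_induct)
  case empty
  then show ?case using D by (auto simp: directed_in_def)
next
  case (insert d S)
  then obtain z where z: "z \<in> D" "\<forall>d\<in>S. d \<sqsubseteq>\<^bsub>product_order I L\<^esub> z" by auto
  obtain w where w: "w \<in> D" "d \<sqsubseteq>\<^bsub>product_order I L\<^esub> w" "z \<sqsubseteq>\<^bsub>product_order I L\<^esub> w"
    using D insert.prems z(1) unfolding directed_in_def by blast
  have "e \<sqsubseteq>\<^bsub>product_order I L\<^esub> w" if e: "e \<in> S" for e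
    unfolding product_order_le
  proof
    fix i assume i: "i \<in> I"
    interpret partial_order "L i" using L[OF i] .
    have "e \<in> D" using e insert.prems by blast
    then have "e i \<in> carrier (L i)" "z i \<in> carrier (L i)" "w i \<in> carrier (L i)"
      using D z w i unfolding directed_in_def product_order_carrier by auto
    then show "e i \<sqsubseteq>\<^bsub>L i\<^esub> w i"
      using z(2) w(3) e i unfolding product_order_le by (meson le_trans)
  qed
  then show ?case using w by auto
qed

text \<open>A basic box restricts only finitely many coordinates. Each restriction is met by some
  member of the directed set, and a common upper bound of these members meets them all.\<close>

lemma scott_open_product_if_openin:
  assumes L: "\<And>i. i \<in> I \<Longrightarrow> partial_order (L i)"
    and op: "openin (product_topology (\<lambda>i. scott_topology (L i)) I) H"
  shows "scott_open (product_order I L) H"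
proof -
  have box: "\<exists>U. finite {i \<in> I. U i \<noteq> carrier (L i)} \<and> (\<forall>i\<in>I. scott_open (L i) (U i)) \<and>
      x \<in> Pi\<^sub>E I U \<and> Pi\<^sub>E I U \<subseteq> H" if "x \<in> H" for x
    using op that unfolding openin_product_topology_alt openin_scott_topology topspace_scott_topology
    by blast
  have sub: "H \<subseteq> carrier (product_order I L)"
    using openin_subset[OF op] by (simp add: product_order_carrier topspace_scott_topology)
  show ?thesis
    unfolding scott_open_def
  proof (intro conjI ballI allI impI)
    show "H \<subseteq> carrier (product_order I L)" by (rule sub)
  next
    fix x y assume x: "x \<in> H" and y: "y \<in> carrier (product_order I L)" "x \<sqsubseteq>\<^bsub>product_order I L\<^esub> y"
    obtain U where U: "\<forall>i\<in>I. scott_open (L i) (U i)" "x \<in> Pi\<^sub>E I U" "Pi\<^sub>E I U \<subseteq> H"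
      using box[OF x] by blast
    have "y i \<in> U i" if i: "i \<in> I" for i
    proof -
      have "x i \<in> U i" "y i \<in> carrier (L i)" "x i \<sqsubseteq>\<^bsub>L i\<^esub> y i"
        using U(2) y i by (auto simp: product_order_carrier product_order_le)
      then show ?thesis using U(1) i unfolding scott_open_def by blast
    qed
    then have "y \<in> Pi\<^sub>E I U" using y(1) by (auto simp: product_order_carrier PiE_iff)
    then show "y \<in> H" using U(3) by blast
  next
    fix D s assume D: "directed_in (product_order I L) D"
      and s: "is_lub (product_order I L) s D" "s \<in> H"
    have DL: "D \<subseteq> carrier (product_order I L)" using D by (simp add: directed_in_def)
    obtain U where U: "finite {i \<in> I. U i \<noteq> carrier (L i)}" "\<And>i. i \<in> I \<Longrightarrow> scott_open (L i) (U i)"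
        "s \<in> Pi\<^sub>E I U" "Pi\<^sub>E I U \<subseteq> H"
      using box[OF s(2)] by blast
    let ?J = "{i \<in> I. U i \<noteq> carrier (L i)}"
    have "\<exists>d\<in>D. d i \<in> U i" if i: "i \<in> I" for i
    proof -
      have "(\<lambda>f. f i) ` D \<inter> U i \<noteq> {}"
        using U(2)[OF i] directed_in_product_component[OF D i] is_lub_product_component[OF s(1) DL i]
          U(3) i unfolding scott_open_def by blast
      then show ?thesis by blast
    qed
    then obtain d where d: "\<And>i. i \<in> I \<Longrightarrow> d i \<in> D" "\<And>i. i \<in> I \<Longrightarrow> d i i \<in> U i" by metis
    obtain z where z: "z \<in> D" "\<forall>e\<in>d ` ?J. e \<sqsubseteq>\<^bsub>product_order I L\<^esub> z"
      using directed_in_product_finite_upper_bound[OF D L, of "d ` ?J"] U(1) d(1) by auto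
    have zL: "z \<in> carrier (product_order I L)" using z DL by blast
    have "z i \<in> U i" if i: "i \<in> I" for i
    proof (cases "U i = carrier (L i)")
      case True
      then show ?thesis using zL i by (auto simp: product_order_carrier)
    next
      case False
      then have "d i i \<sqsubseteq>\<^bsub>L i\<^esub> z i" using z(2) i by (auto simp: product_order_le)
      moreover have "z i \<in> carrier (L i)" using zL i by (auto simp: product_order_carrier)
      ultimately show ?thesis using U(2)[OF i] d(2)[OF i] unfolding scott_open_def by blast
    qed
    then have "z \<in> Pi\<^sub>E I U" using zL by (auto simp: product_order_carrier PiE_iff)
    then have "z \<in> H" using U(4) by blast
    then show "D \<inter> H \<noteq> {}" using z(1) by blast
  qed
qed

section \<open>Scott open sets of the product contain boxes around their points\<close>

locale presented_family =
  fixes I :: "'i set" and L :: "'i \<Rightarrow> 'a gorder" and X :: "'i \<Rightarrow> 'x set"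
    and R :: "'i \<Rightarrow> ('x set set \<times> 'x set set) set" and q :: "'i \<Rightarrow> 'x set set \<Rightarrow> 'a"
  assumes presentation: "i \<in> I \<Longrightarrow> frame_presentation (L i) (X i) (R i) (q i)"
begin

text \<open>A finite set of such pairs codes a family of compact elements that is bottom at all but
  finitely many indices, so one finiteness condition covers all coordinates at once.\<close>

abbreviation points :: "('i \<times> 'x set) set"
  where "points \<equiv> Sigma I (\<lambda>i. Fpow (X i))"

abbreviation span :: "('i \<times> 'x set) set \<Rightarrow> 'i \<Rightarrow> 'x set set"
  where "span E i \<equiv> free_frame_span (X i) (E `` {i})"

definition val :: "('i \<Rightarrow> 'x set set) \<Rightarrow> 'i \<Rightarrow> 'a"
  where "val W = (\<lambda>i\<in>I. q i (W i))"

lemma val_closed: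
  "(\<And>i. i \<in> I \<Longrightarrow> W i \<in> carrier (free_frame (X i))) \<Longrightarrow> val W \<in> carrier (product_order I L)"
  using frame_presentation.q_closed[OF presentation] by (auto simp: val_def product_order_carrier)

lemma val_mono:
  assumes "\<And>i. i \<in> I \<Longrightarrow> V i \<in> carrier (free_frame (X i))"
    "\<And>i. i \<in> I \<Longrightarrow> W i \<in> carrier (free_frame (X i))" "\<And>i. i \<in> I \<Longrightarrow> V i \<subseteq> W i"
  shows "val V \<sqsubseteq>\<^bsub>product_order I L\<^esub> val W"
  using assms frame_presentation.q_mono[OF presentation] by (auto simp: val_def product_order_le)

text \<open>The finite subsets of \<open>Sigma I W\<close> are directed under inclusion, and the
  supremum of their values is \<open>val W\<close> because every \<open>W i\<close> is the union of
  the spans of its singletons.\<close>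

lemma val_span_in_scott_open:
  assumes H: "scott_open (product_order I L) H"
    and W: "\<And>i. i \<in> I \<Longrightarrow> W i \<in> carrier (free_frame (X i))" and WH: "val W \<in> H"
  shows "\<exists>E. finite E \<and> E \<subseteq> Sigma I W \<and> val (span E) \<in> H"
proof -
  define \<E> where "\<E> = {E. finite E \<and> E \<subseteq> Sigma I W}"
  let ?D = "(\<lambda>E. val (span E)) ` \<E>"
  have span_le: "span E i \<subseteq> W i" if "E \<in> \<E>" "i \<in> I" for E i
    using that W by (intro free_frame_span_least) (auto simp: \<E>_def)
  have DP: "?D \<subseteq> carrier (product_order I L)"
    by (auto intro!: val_closed free_frame_span_closed)
  have "directed_in (product_order I L) ?D"
    unfolding directed_in_def
  proof (intro conjI ballI)
    show "?D \<subseteq> carrier (product_order I L)" by (rule DP)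
    have "{} \<in> \<E>" by (simp add: \<E>_def)
    then show "?D \<noteq> {}" by blast
    fix x y assume "x \<in> ?D" "y \<in> ?D"
    then obtain E E' where E: "E \<in> \<E>" "x = val (span E)" "E' \<in> \<E>" "y = val (span E')" by blast
    have "E \<union> E' \<in> \<E>" using E by (auto simp: \<E>_def)
    moreover have "x \<sqsubseteq>\<^bsub>product_order I L\<^esub> val (span (E \<union> E'))"
      "y \<sqsubseteq>\<^bsub>product_order I L\<^esub> val (span (E \<union> E'))"
      unfolding E by (intro val_mono free_frame_span_closed free_frame_span_mono; blast)+
    ultimately show "\<exists>z\<in>?D. x \<sqsubseteq>\<^bsub>product_order I L\<^esub> z \<and> y \<sqsubseteq>\<^bsub>product_order I L\<^esub> z" by blast
  qed
  moreover have "is_lub (product_order I L) (val W) ?D"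
  proof -
    have least: "val W \<sqsubseteq>\<^bsub>product_order I L\<^esub> y"
      if y: "y \<in> carrier (product_order I L)" "\<And>d. d \<in> ?D \<Longrightarrow> d \<sqsubseteq>\<^bsub>product_order I L\<^esub> y" for y
      unfolding product_order_le
    proof
      fix i assume i: "i \<in> I"
      interpret frame_presentation "L i" "X i" "R i" "q i" by (rule presentation[OF i])
      have "W i = \<Union>((\<lambda>F. free_frame_span (X i) {F}) ` W i)"
        using free_frame_carrierD[OF W[OF i]] by (auto simp: free_frame_span_def)
      moreover have "q i (\<Union>((\<lambda>F. free_frame_span (X i) {F}) ` W i)) \<sqsubseteq>\<^bsub>L i\<^esub> y i"
      proof (rule q_Union_le)
        show "y i \<in> carrier (L i)" using y(1) i by (auto simp: product_order_carrier)
        fix A assume "A \<in> (\<lambda>F. free_frame_span (X i) {F}) ` W i"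
        then obtain F where F: "F \<in> W i" "A = free_frame_span (X i) {F}" by blast
        \<comment> \<open>A single point is itself a finite approximation, so \<open>y\<close>
          bounds the value of its span.\<close>
        have "{(i, F)} \<in> \<E>" using F i by (auto simp: \<E>_def)
        then have "val (span {(i, F)}) \<sqsubseteq>\<^bsub>product_order I L\<^esub> y" using y(2) by blast
        moreover have "{(i, F)} `` {i} = {F}" by auto
        ultimately show "q i A \<sqsubseteq>\<^bsub>L i\<^esub> y i"
          using i F by (auto simp: product_order_le val_def dest!: bspec)
      qed (auto intro: free_frame_span_closed)
      ultimately show "val W i \<sqsubseteq>\<^bsub>L i\<^esub> y i" using i by (simp add: val_def)
    qed
    have upper: "d \<sqsubseteq>\<^bsub>product_order I L\<^esub> val W" if "d \<in> ?D" for d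
      using that W span_le by (auto intro!: val_mono free_frame_span_closed)
    show ?thesis by (rule is_lubI[OF DP val_closed[OF W] upper least])
  qed
  ultimately have "?D \<inter> H \<noteq> {}" using H WH unfolding scott_open_def by blast
  then show ?thesis unfolding \<E>_def by blast
qed

text \<open>One step of the construction: the spans shrink, and at index \<open>j\<close> the
  descendants of members of \<open>V\<close> are pushed into \<open>U\<close>. The same ancestor
  \<open>F\<close> has to serve both purposes.\<close>

definition refines :: "('i \<times> 'x set set \<times> 'x set set) \<Rightarrow> ('i \<times> 'x set) set \<Rightarrow> ('i \<times> 'x set) set \<Rightarrow> bool"
  where "refines r E E' \<longleftrightarrow> (case r of (j, V, U) \<Rightarrow>
    \<forall>i G. (i, G) \<in> E' \<longrightarrow> (\<exists>F. (i, F) \<in> E \<and> F \<subseteq> G \<and> (i = j \<and> F \<in> V \<longrightarrow> G \<in> U)))"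

lemma refinesD:
  "\<lbrakk>refines (j, V, U) E E'; (i, G) \<in> E'\<rbrakk> \<Longrightarrow>
    \<exists>F. (i, F) \<in> E \<and> F \<subseteq> G \<and> (i = j \<and> F \<in> V \<longrightarrow> G \<in> U)"
  by (simp add: refines_def)

lemma refines_span_le:
  assumes "refines r E E'"
  shows "span E' i \<subseteq> span E i"
proof
  fix G assume "G \<in> span E' i"
  then obtain G' where G: "G \<in> Fpow (X i)" "(i, G') \<in> E'" "G' \<subseteq> G"
    by (auto simp: free_frame_span_def)
  then obtain F where "(i, F) \<in> E" "F \<subseteq> G'" using assms refinesD by (cases r) blast
  then show "G \<in> span E i" using G by (auto simp: free_frame_span_def)
qed

text \<open>Meeting the generators in \<open>V\<close> with \<open>U\<close> leaves the value in
  \<open>H\<close> unchanged, and finitely many points below the modified family again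
  suffice.\<close>

lemma refines_exists:
  assumes H: "scott_open (product_order I L) H"
    and E: "finite E" "E \<subseteq> points" "val (span E) \<in> H"
    and r: "j \<in> I \<Longrightarrow> (V, U) \<in> R j \<or> V = {} \<and> U = {}"
  shows "\<exists>E'. (finite E' \<and> E' \<subseteq> points \<and> val (span E') \<in> H) \<and> refines (j, V, U) E E'"
proof -
  define W where "W i = {G \<in> Fpow (X i). \<exists>F. (i, F) \<in> E \<and> F \<subseteq> G \<and> (i = j \<and> F \<in> V \<longrightarrow> G \<in> U)}" for i
  have W: "W i \<in> carrier (free_frame (X i)) \<and> q i (W i) = q i (span E i)" if i: "i \<in> I" for i
  proof -
    interpret frame_presentation "L i" "X i" "R i" "q i" by (rule presentation[OF i])
    \<comment> \<open>\<open>B F\<close> is the contribution of the point \<open>F\<close> to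
      \<open>W i\<close>, so \<open>W i\<close> and the span of \<open>E\<close> can be compared
      point by point.\<close>
    define B where "B F = (if i = j \<and> F \<in> V then free_frame_span (X i) {F} \<inter> U
      else free_frame_span (X i) {F})" for F
    have B: "B F \<in> carrier (free_frame (X i)) \<and> q i (B F) = q i (free_frame_span (X i) {F})" for F
    proof (cases "i = j \<and> F \<in> V")
      case True
      \<comment> \<open>\<open>F \<in> V\<close> excludes the vacuous alternative
        \<open>V = {}\<close>.\<close>
      then have VU: "(V, U) \<in> R i" using r i by auto
      then have V: "V \<in> carrier (free_frame (X i))" "U \<in> carrier (free_frame (X i))"
        using R_closed by auto
      have "free_frame_span (X i) {F} \<subseteq> V" using True V(1) by (intro free_frame_span_least) auto
      then have "q i (free_frame_span (X i) {F} \<inter> U) = q i (free_frame_span (X i) {F})"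
        by (intro q_relation_below[OF VU free_frame_span_closed])
      then show ?thesis
        using True free_frame_carrier_Int[OF free_frame_span_closed V(2)] by (simp add: B_def)
    next
      case False
      then show ?thesis by (auto simp: B_def free_frame_span_closed)
    qed
    have WB: "W i = \<Union>(B ` (E `` {i}))"
      unfolding W_def B_def free_frame_span_def by (auto split: if_splits)
    have SB: "span E i = \<Union>((\<lambda>F. free_frame_span (X i) {F}) ` (E `` {i}))"
      by (auto simp: free_frame_span_def)
    have c: "B ` (E `` {i}) \<subseteq> carrier (free_frame (X i))"
      "(\<lambda>F. free_frame_span (X i) {F}) ` (E `` {i}) \<subseteq> carrier (free_frame (X i))"
      using B by (auto simp: free_frame_span_closed)
    have "q i (W i) = q i (span E i)"
      unfolding WB SB q_Union[OF c(1)] q_Union[OF c(2)] image_image using B by simp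
    then show ?thesis unfolding WB using free_frame_carrier_Union[OF c(1)] by simp
  qed
  have "val W = val (span E)" using W by (auto simp: val_def)
  then have "val W \<in> H" using E(3) by simp
  then obtain E' where E': "finite E'" "E' \<subseteq> Sigma I W" "val (span E') \<in> H"
    using val_span_in_scott_open[OF H, of W] W by blast
  have "Sigma I W \<subseteq> points" by (auto simp: W_def)
  moreover have "refines (j, V, U) E E'" using E'(2) by (auto simp: refines_def W_def)
  ultimately show ?thesis using E' by blast
qed

text \<open>The sides of the box are the images of the filters \<G>. Outside the finite index set
  \<open>J\<close> the spans are empty, so there the filter and its image are everything.\<close>

lemma scott_open_product_box:
  assumes H: "scott_open (product_order I L) H" and x: "x \<in> H"
  shows "\<exists>U. finite {i \<in> I. U i \<noteq> carrier (L i)} \<and> (\<forall>i\<in>I. scott_open (L i) (U i)) \<and>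
      x \<in> Pi\<^sub>E I U \<and> Pi\<^sub>E I U \<subseteq> H"
proof -
  have xP: "x \<in> carrier (product_order I L)" using H x by (auto simp: scott_open_def)
  have "\<forall>i\<in>I. \<exists>A. A \<in> carrier (free_frame (X i)) \<and> q i A = x i"
    using xP frame_presentation.q_preimage[OF presentation] unfolding product_order_carrier
    by (auto simp: PiE_iff)
  then obtain W where W: "\<And>i. i \<in> I \<Longrightarrow> W i \<in> carrier (free_frame (X i))"
      and Wx: "\<And>i. i \<in> I \<Longrightarrow> q i (W i) = x i" by metis
  have "val W = x" using xP Wx by (auto simp: val_def product_order_carrier PiE_iff extensional_def)
  then obtain E0 where E0: "finite E0" "E0 \<subseteq> Sigma I W" "val (span E0) \<in> H"
    using val_span_in_scott_open[OF H W] x by auto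
  have E0p: "E0 \<subseteq> points" using E0(2) W free_frame_carrierD(1) by blast
  define J where "J = fst ` E0"
  have J: "finite J" "J \<subseteq> I" using E0 by (auto simp: J_def)

  \<comment> \<open>The vacuous relation makes \<open>T\<close> nonempty, as \<open>from_nat_into\<close> needs.\<close>
  define T where "T = insert (undefined, {}, {}) (Sigma J R)"
  have cT: "countable T"
    unfolding T_def using J frame_presentation.R_countable[OF presentation]
    by (intro countable_insert countable_SIGMA) (auto intro: countable_finite)
  \<comment> \<open>The first component of the decoded pair selects the relation and the second is a
    free counter, so every relation recurs beyond any given stage.\<close>
  define \<rho> where "\<rho> n = from_nat_into T (fst (prod_decode n))" for n
  have \<rho>T: "\<rho> n \<in> T" for n unfolding \<rho>_def by (intro from_nat_into) (simp add: T_def)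
  have \<rho>_cofinal: "\<exists>n\<ge>k. \<rho> n = r" if "r \<in> T" for r k
  proof -
    obtain a where "from_nat_into T a = r" using from_nat_into_surj[OF cT \<open>r \<in> T\<close>] by blast
    then have "\<rho> (prod_encode (a, k)) = r" by (simp add: \<rho>_def)
    then show ?thesis using le_prod_encode_2 by blast
  qed
  \<comment> \<open>The clause for \<open>n = 0\<close> pins the start of the chosen sequence to
    \<open>E0\<close>; at successor stages it is vacuous.\<close>
  have "\<exists>E. \<forall>n::nat. (finite (E n) \<and> E n \<subseteq> points \<and> val (span (E n)) \<in> H \<and> (n = 0 \<longrightarrow> E n = E0)) \<and>
      refines (\<rho> n) (E n) (E (Suc n))"
  proof (rule dependent_nat_choice)
    show "\<exists>E. finite E \<and> E \<subseteq> points \<and> val (span E) \<in> H \<and> (0 = 0 \<longrightarrow> E = E0)"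
      using E0 E0p by blast
    fix E and n :: nat
    assume E: "finite E \<and> E \<subseteq> points \<and> val (span E) \<in> H \<and> (n = 0 \<longrightarrow> E = E0)"
    obtain j V U where r: "\<rho> n = (j, V, U)" by (metis prod_cases3)
    then have "(V, U) \<in> R j \<or> V = {} \<and> U = {}" using \<rho>T[of n] by (auto simp: T_def)
    then show "\<exists>E'. (finite E' \<and> E' \<subseteq> points \<and> val (span E') \<in> H \<and> (Suc n = 0 \<longrightarrow> E' = E0)) \<and>
        refines (\<rho> n) E E'"
      unfolding r using refines_exists[OF H] E by simp
  qed
  then obtain E where E': "\<forall>n::nat. (finite (E n) \<and> E n \<subseteq> points \<and> val (span (E n)) \<in> H \<and> (n = 0 \<longrightarrow> E n = E0)) \<and>
      refines (\<rho> n) (E n) (E (Suc n))"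
    by (elim exE)
  then have E: "finite (E n)" "E n \<subseteq> points" "val (span (E n)) \<in> H"
    and ref: "refines (\<rho> n) (E n) (E (Suc n))" for n
    by simp_all
  have E_0: "E 0 = E0" using E' by simp
  have dec: "span (E n) i \<subseteq> span (E m) i" if "m \<le> n" for m n i
    by (rule lift_Suc_antimono_le[of "\<lambda>n. span (E n) i", OF refines_span_le[OF ref] that])
  have empty: "span (E n) i = {}" if "i \<notin> J" for n i
  proof -
    have "span (E 0) i = {}" using that by (force simp: E_0 J_def free_frame_span_def)
    then show ?thesis using dec[of 0 n i] by simp
  qed
  \<comment> \<open>The spans decrease, so this is an increasing union of principal filters of
    compact elements.\<close>
  define \<G> where "\<G> i = {A \<in> carrier (free_frame (X i)). \<exists>k. span (E k) i \<subseteq> A}" for i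
  have fin\<G>: "finitary_upset (X i) (\<G> i)" for i
    unfolding \<G>_def
  proof (rule finitary_upset_span_chain)
    show "finite (E k `` {i})" for k using E(1) by (simp add: finite_Image)
    show "E k `` {i} \<subseteq> Fpow (X i)" for k using E(2) by blast
  qed
  have transfer: "U \<inter> C \<union> D \<in> \<G> i"
    if i: "i \<in> I" and VU: "(V, U) \<in> R i" and CD: "C \<in> carrier (free_frame (X i))" "D \<in> carrier (free_frame (X i))"
      and mem: "V \<inter> C \<union> D \<in> \<G> i" for i V U C D
  proof -
    interpret frame_presentation "L i" "X i" "R i" "q i" by (rule presentation[OF i])
    have U: "U \<in> carrier (free_frame (X i))" using VU R_closed by auto
    have UCD: "U \<inter> C \<union> D \<in> carrier (free_frame (X i))"
      using U CD free_frame_carrier_Un free_frame_carrier_Int by blast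
    show ?thesis
    proof (cases "i \<in> J")
      case False
      then show ?thesis using empty UCD by (simp add: \<G>_def)
    next
      case True
      obtain k where k: "span (E k) i \<subseteq> V \<inter> C \<union> D" using mem by (auto simp: \<G>_def)
      \<comment> \<open>The relation has to be treated at or after stage \<open>k\<close>, since
        only from there on do all points lie in \<open>V \<inter> C \<union> D\<close>.\<close>
      obtain n where n: "n \<ge> k" "\<rho> n = (i, V, U)"
        using \<rho>_cofinal[of "(i, V, U)"] True VU by (auto simp: T_def)
      have "G \<in> U \<inter> C \<union> D" if G: "G \<in> E (Suc n) `` {i}" for G
      proof -
        have GX: "G \<in> Fpow (X i)" using G E(2) by blast
        obtain F where F: "(i, F) \<in> E n" "F \<subseteq> G" "F \<in> V \<Longrightarrow> G \<in> U"
          using refinesD[OF ref[of n, unfolded n(2)], of i G] G by auto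
        have "F \<in> Fpow (X i)" using F(1) E(2) by blast
        then have "F \<in> span (E n) i" using F(1) by (auto simp: free_frame_span_def)
        then have "F \<in> V \<inter> C \<union> D" using dec[OF n(1)] k by blast
        \<comment> \<open>If the ancestor \<open>F\<close> lies in \<open>D\<close>, so does
          \<open>G\<close>. Otherwise \<open>F\<close> lies in \<open>V\<close> and
          \<open>C\<close>, which puts \<open>G\<close> in \<open>U\<close> by the refinement and in
          \<open>C\<close> by upward closure.\<close>
        then show ?thesis using F(2,3) GX CD free_frame_carrierD(2) by blast
      qed
      then have "span (E (Suc n)) i \<subseteq> U \<inter> C \<union> D" using UCD by (intro free_frame_span_least) auto
      then show ?thesis using UCD by (auto simp: \<G>_def)
    qed
  qed
  have sat: "B \<in> \<G> i"
    if i: "i \<in> I" and AB: "A \<in> \<G> i" "B \<in> carrier (free_frame (X i))" "q i A = q i B" for i A B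
  proof -
    interpret frame_presentation "L i" "X i" "R i" "q i" by (rule presentation[OF i])
    have "R i \<subseteq> separation_congruence (X i) (\<G> i)"
    proof
      fix p assume p: "p \<in> R i"
      obtain V U where VU: "p = (V, U)" "(V, U) \<in> R i" "(U, V) \<in> R i"
        using p R_sym by (cases p) (auto simp: sym_def)
      then show "p \<in> separation_congruence (X i) (\<G> i)"
        using R_closed transfer[OF i] by (auto simp: separation_congruence_def)
    qed
    moreover have A: "A \<in> carrier (free_frame (X i))" using AB(1) by (simp add: \<G>_def)
    ultimately have "(A, B) \<in> separation_congruence (X i) (\<G> i)"
      using kernel_least[OF frame_congruence_separation[OF fin\<G>]] AB by blast
    then have "A \<inter> C \<union> D \<in> \<G> i \<longleftrightarrow> B \<inter> C \<union> D \<in> \<G> i"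
      if "C \<in> carrier (free_frame (X i))" "D \<in> carrier (free_frame (X i))" for C D
      using that by (auto simp: separation_congruence_def)
    \<comment> \<open>Top for \<open>C\<close> and bottom for \<open>D\<close> give the trivial
      context.\<close>
    from this[of "Fpow (X i)" "{}"] show "B \<in> \<G> i"
      using AB(1) free_frame_carrierD(1)[OF A] free_frame_carrierD(1)[OF AB(2)]
      by (simp add: inf_absorb1 free_frame_def)
  qed
  show ?thesis
  proof (intro exI[of _ "\<lambda>i. q i ` \<G> i"] conjI ballI subsetI)
    have "q i ` \<G> i = carrier (L i)" if "i \<in> I" "i \<notin> J" for i
      using frame_presentation.surj[OF presentation[OF that(1)]] empty[OF that(2)] by (simp add: \<G>_def)
    then have "{i \<in> I. q i ` \<G> i \<noteq> carrier (L i)} \<subseteq> J" by blast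
    then show "finite {i \<in> I. q i ` \<G> i \<noteq> carrier (L i)}" using J(1) finite_subset by blast
    show "scott_open (L i) (q i ` \<G> i)" if "i \<in> I" for i
      using frame_presentation.scott_open_image[OF presentation[OF that] fin\<G>] sat[OF that] by blast
    have "W i \<in> \<G> i" if i: "i \<in> I" for i
    proof -
      have "span (E 0) i \<subseteq> W i"
        unfolding E_0 using E0(2) W[OF i] by (intro free_frame_span_least) auto
      then show ?thesis using W[OF i] by (auto simp: \<G>_def)
    qed
    then have "x i \<in> q i ` \<G> i" if "i \<in> I" for i
      using that Wx[OF that] by (metis imageI)
    then show "x \<in> (\<Pi>\<^sub>E i\<in>I. q i ` \<G> i)" using xP by (auto simp: product_order_carrier PiE_iff)
    fix y assume y: "y \<in> (\<Pi>\<^sub>E i\<in>I. q i ` \<G> i)"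
    have "\<forall>i\<in>I. \<exists>A k. A \<in> carrier (free_frame (X i)) \<and> q i A = y i \<and> span (E k) i \<subseteq> A"
    proof
      fix i assume "i \<in> I"
      then have "y i \<in> q i ` \<G> i" using y by auto
      then obtain A where "A \<in> \<G> i" "q i A = y i" by auto
      then show "\<exists>A k. A \<in> carrier (free_frame (X i)) \<and> q i A = y i \<and> span (E k) i \<subseteq> A"
        unfolding \<G>_def by blast
    qed
    then obtain A k where A: "\<And>i. i \<in> I \<Longrightarrow> A i \<in> carrier (free_frame (X i))"
        "\<And>i. i \<in> I \<Longrightarrow> q i (A i) = y i" "\<And>i. i \<in> I \<Longrightarrow> span (E (k i)) i \<subseteq> A i"
      by metis
    \<comment> \<open>The stages \<open>k i\<close> are unbounded in general, but only those at the
      finitely many indices in \<open>J\<close> matter; elsewhere the spans are empty.\<close>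
    obtain m where m: "\<And>i. i \<in> J \<Longrightarrow> k i \<le> m"
      using J(1) by (meson finite_imageI finite_nat_set_iff_bounded_le imageI)
    have "span (E m) i \<subseteq> A i" if "i \<in> I" for i
      using A(3)[OF that] dec[OF m, of i i] empty[of i m] by (cases "i \<in> J") auto
    then have "val (span (E m)) \<sqsubseteq>\<^bsub>product_order I L\<^esub> val A"
      using A(1) by (intro val_mono free_frame_span_closed)
    moreover have "val A = y" using y A(2) by (auto simp: val_def PiE_iff extensional_def)
    moreover have "y \<in> carrier (product_order I L)" using val_closed[OF A(1)] \<open>val A = y\<close> by simp
    ultimately show "y \<in> H" using H E(3)[of m] unfolding scott_open_def by blast
  qed
qed

end

section \<open>Equality of the two topologies\<close>

theorem theorem1p1:
  fixes I :: "'i set" and L :: "'i \<Rightarrow> 'a gorder"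
  assumes "\<And>i. i \<in> I \<Longrightarrow> frame (L i)"
    and "\<And>i. i \<in> I \<Longrightarrow> countably_presented (L i)"
  shows "scott_topology (product_order I L) = product_topology (\<lambda>i. scott_topology (L i)) I"
proof -
  have "\<forall>i\<in>I. \<exists>(X :: nat set) R q. frame_presentation (L i) X R q"
    using assms frame_presentation_exists by blast
  then obtain X :: "'i \<Rightarrow> nat set" and R q
    where "\<And>i. i \<in> I \<Longrightarrow> frame_presentation (L i) (X i) (R i) (q i)" by metis
  then interpret presented_family I L X R q by (rule presented_family.intro)
  have po: "partial_order (L i)" if "i \<in> I" for i
    using assms(1)[OF that] by (simp add: frame_def complete_lattice_def)
  show ?thesis
    unfolding topology_eq openin_scott_topology
  proof (intro allI iffI)
    fix H assume "scott_open (product_order I L) H"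
    then show "openin (product_topology (\<lambda>i. scott_topology (L i)) I) H"
      unfolding openin_product_topology_alt openin_scott_topology topspace_scott_topology
      using scott_open_product_box[of H] by blast
  next
    fix H assume "openin (product_topology (\<lambda>i. scott_topology (L i)) I) H"
    with po show "scott_open (product_order I L) H"
      by (rule scott_open_product_if_openin[of I L H])
  qed
qed

end
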